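(* Let $\mu,\nu,k$ be integers with $0\le k\le\mu<\nu$. The map $\mathcal{T}^\nu_{\mu,k}:B(\mathcal{H}_\mu)\to B(\mathcal{H}_{\mu+\nu-2k})$, $\mathcal{T}^\nu_{\mu,k}(A)=P_k(A\otimes I)P_k^*$, is completely positive, and the map $\widehat{\mathcal{T}}^\nu_{\mu,k}(A)=\frac{\mu+1}{\mu+\nu-2k+1}P_k(A\otimes I)P_k^*$ is completely positive and trace-preserving.
   Context: For an integer $\tau\ge0$, $\mathcal{H}_\tau$ is the $(\tau+1)$-dimensional space of polynomials in one complex variable of degree $\le\tau$, with inner product $\langle f,g\rangle=\int_{\mathbb{C}}f\overline{g}\,d\iota_\tau$, $d\iota_\tau(z)=\frac{\tau+1}{(1+|z|^2)^\tau}\frac{dA(z)}{\pi(1+|z|^2)^2}$ ($dA$ Lebesgue measure). $SU(2)$ acts unitarily and irreducibly on $\mathcal{H}_\tau$ by $(g\cdot f)(z)=(-\overline{b}z+\overline{a})^\tau f\big(\frac{az+b}{-\overline{b}z+\overline{a}}\big)$ where $g^{-1}=\begin{pmatrix}a&b\\-\overline b&\overline a\end{pmatrix}$. $\mathcal{H}_\mu\otimes\mathcal{H}_\nu$ is realized as polynomials $F(z,w)$ of degree $\le\mu$ in $z$, $\le\nu$ in $w$, with the inner product of $L^2(d\iota_\mu(z)d\iota_\nu(w))$; $I$ is the identity on $\mathcal{H}_\nu$. Define $J_k:\mathcal{H}_\mu\otimes\mathcal{H}_\nu\to\mathcal{H}_{\mu+\nu-2k}$ by $J_k(F)(\xi)=\int_{\mathbb{C}^2}F(z,w)(\overline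 z-\overline w)^k(1+\xi\overline z)^{\mu-k}(1+\xi\overline w)^{\nu-k}d\iota_\mu(z)d\iota_\nu(w)$, let $C_{\mu,\nu,k}>0$ be given by $C_{\mu,\nu,k}^2=\frac{(-\nu)_k(-\mu)_k}{k!(\mu+\nu-2k+2)_k}$ (rising Pochhammer symbols $(a)_n=a(a+1)\cdots(a+n-1)$), and $P_k:=C_{\mu,\nu,k}J_k$; $P_k$ is the $SU(2)$-equivariant coisometry onto the component $\mathcal{H}_{\mu+\nu-2k}$ in $\mathcal{H}_\mu\otimes\mathcal{H}_\nu\cong\bigoplus_{j=0}^\mu\mathcal{H}_{\mu+\nu-2j}$. *)

theory Defs
  imports "HOL-Analysis.Analysis"
begin

definition Hsp :: "nat \<Rightarrow> (complex \<Rightarrow> complex) set" where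
  "Hsp \<tau> = {f. \<exists>c::nat \<Rightarrow> complex. f = (\<lambda>z. \<Sum>i\<le>\<tau>. c i * z ^ i)}"

text \<open>The tensor product H_mu (x) H_nu, realized as polynomials F(z,w) of degree at most mu in z
  and at most nu in w (curried).\<close>
definition Tsp :: "nat \<Rightarrow> nat \<Rightarrow> (complex \<Rightarrow> complex \<Rightarrow> complex) set" where
  "Tsp \<mu> \<nu> = {F. \<exists>c::nat \<Rightarrow> nat \<Rightarrow> complex.
      F = (\<lambda>z w. \<Sum>i\<le>\<mu>. \<Sum>j\<le>\<nu>. c i j * z ^ i * w ^ j)}"

definition dens :: "nat \<Rightarrow> complex \<Rightarrow> complex" where
  "dens \<tau> z = complex_of_real ((real \<tau> + 1) / (pi * (1 + (cmod z)\<^sup>2) ^ (\<tau> + 2)))"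

definition ipH :: "nat \<Rightarrow> (complex \<Rightarrow> complex) \<Rightarrow> (complex \<Rightarrow> complex) \<Rightarrow> complex" where
  "ipH \<tau> f g = (\<integral>z. f z * cnj (g z) * dens \<tau> z \<partial>lborel)"

definition ipT :: "nat \<Rightarrow> nat \<Rightarrow> (complex \<Rightarrow> complex \<Rightarrow> complex) \<Rightarrow> (complex \<Rightarrow> complex \<Rightarrow> complex) \<Rightarrow> complex" where
  "ipT \<mu> \<nu> F G = (\<integral>p. F (fst p) (snd p) * cnj (G (fst p) (snd p)) * dens \<mu> (fst p) * dens \<nu> (snd p)
                     \<partial>(lborel \<Otimes>\<^sub>M lborel))"

definition lin_on :: "('a \<Rightarrow> complex) set \<Rightarrow> (('a \<Rightarrow> complex) \<Rightarrow> ('b \<Rightarrow> complex)) \<Rightarrow> bool" where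
  "lin_on V L = (\<forall>f\<in>V. \<forall>g\<in>V. \<forall>a b. L (\<lambda>z. a * f z + b * g z) = (\<lambda>z. a * L f z + b * L g z))"

text \<open>B(H_tau): linear operators on H_tau (values outside H_tau are irrelevant).\<close>
definition Bop :: "nat \<Rightarrow> ((complex \<Rightarrow> complex) \<Rightarrow> (complex \<Rightarrow> complex)) set" where
  "Bop \<tau> = {A. (\<forall>f\<in>Hsp \<tau>. A f \<in> Hsp \<tau>) \<and> lin_on (Hsp \<tau>) A}"

definition pcoeff :: "nat \<Rightarrow> (complex \<Rightarrow> complex) \<Rightarrow> nat \<Rightarrow> complex" where
  "pcoeff \<tau> f = (THE c. f = (\<lambda>z. \<Sum>i\<le>\<tau>. c i * z ^ i) \<and> (\<forall>i>\<tau>. c i = 0))"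

definition trH :: "nat \<Rightarrow> ((complex \<Rightarrow> complex) \<Rightarrow> (complex \<Rightarrow> complex)) \<Rightarrow> complex" where
  "trH \<tau> A = (\<Sum>i\<le>\<tau>. pcoeff \<tau> (A (\<lambda>z. z ^ i)) i)"

definition Jk :: "nat \<Rightarrow> nat \<Rightarrow> nat \<Rightarrow> (complex \<Rightarrow> complex \<Rightarrow> complex) \<Rightarrow> complex \<Rightarrow> complex" where
  "Jk \<mu> \<nu> k F = (\<lambda>\<xi>. \<integral>p. F (fst p) (snd p) * (cnj (fst p) - cnj (snd p)) ^ k
        * (1 + \<xi> * cnj (fst p)) ^ (\<mu> - k) * (1 + \<xi> * cnj (snd p)) ^ (\<nu> - k)
        * dens \<mu> (fst p) * dens \<nu> (snd p) \<partial>(lborel \<Otimes>\<^sub>M lborel))"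

definition Ck :: "nat \<Rightarrow> nat \<Rightarrow> nat \<Rightarrow> real" where
  "Ck \<mu> \<nu> k = sqrt (pochhammer (- real \<nu>) k * pochhammer (- real \<mu>) k
                     / (fact k * pochhammer (real (\<mu> + \<nu> - 2 * k + 2)) k))"

definition Pk :: "nat \<Rightarrow> nat \<Rightarrow> nat \<Rightarrow> (complex \<Rightarrow> complex \<Rightarrow> complex) \<Rightarrow> complex \<Rightarrow> complex" where
  "Pk \<mu> \<nu> k F = (\<lambda>\<xi>. complex_of_real (Ck \<mu> \<nu> k) * Jk \<mu> \<nu> k F \<xi>)"

definition Pk_adj :: "nat \<Rightarrow> nat \<Rightarrow> nat \<Rightarrow> (complex \<Rightarrow> complex) \<Rightarrow> (complex \<Rightarrow> complex \<Rightarrow> complex)" where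
  "Pk_adj \<mu> \<nu> k g = (THE G. G \<in> Tsp \<mu> \<nu> \<and>
      (\<forall>F\<in>Tsp \<mu> \<nu>. ipH (\<mu> + \<nu> - 2 * k) (Pk \<mu> \<nu> k F) g = ipT \<mu> \<nu> F G))"

definition tensorI :: "((complex \<Rightarrow> complex) \<Rightarrow> (complex \<Rightarrow> complex)) \<Rightarrow> (complex \<Rightarrow> complex \<Rightarrow> complex) \<Rightarrow> (complex \<Rightarrow> complex \<Rightarrow> complex)" where
  "tensorI A F = (\<lambda>z w. A (\<lambda>z'. F z' w) z)"

definition Tmap :: "nat \<Rightarrow> nat \<Rightarrow> nat \<Rightarrow> ((complex \<Rightarrow> complex) \<Rightarrow> (complex \<Rightarrow> complex))
                     \<Rightarrow> ((complex \<Rightarrow> complex) \<Rightarrow> (complex \<Rightarrow> complex))" where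
  "Tmap \<mu> \<nu> k A = (\<lambda>g. Pk \<mu> \<nu> k (tensorI A (Pk_adj \<mu> \<nu> k g)))"

definition That :: "nat \<Rightarrow> nat \<Rightarrow> nat \<Rightarrow> ((complex \<Rightarrow> complex) \<Rightarrow> (complex \<Rightarrow> complex))
                     \<Rightarrow> ((complex \<Rightarrow> complex) \<Rightarrow> (complex \<Rightarrow> complex))" where
  "That \<mu> \<nu> k A = (\<lambda>g z. complex_of_real ((real \<mu> + 1) / (real (\<mu> + \<nu> - 2 * k) + 1)) * Tmap \<mu> \<nu> k A g z)"

definition block_pos :: "nat \<Rightarrow> nat \<Rightarrow> (nat \<Rightarrow> nat \<Rightarrow> (complex \<Rightarrow> complex) \<Rightarrow> (complex \<Rightarrow> complex)) \<Rightarrow> bool" where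
  "block_pos \<tau> n A = (\<forall>x::nat \<Rightarrow> complex \<Rightarrow> complex. (\<forall>i<n. x i \<in> Hsp \<tau>) \<longrightarrow>
      (let s = (\<Sum>i<n. \<Sum>j<n. ipH \<tau> (A i j (x j)) (x i)) in s \<in> \<real> \<and> 0 \<le> Re s))"

definition completely_positive :: "nat \<Rightarrow> nat \<Rightarrow> (((complex \<Rightarrow> complex) \<Rightarrow> (complex \<Rightarrow> complex))
     \<Rightarrow> ((complex \<Rightarrow> complex) \<Rightarrow> (complex \<Rightarrow> complex))) \<Rightarrow> bool" where
  "completely_positive \<sigma> \<tau> T = (\<forall>n A. (\<forall>i<n. \<forall>j<n. A i j \<in> Bop \<sigma>) \<longrightarrow> block_pos \<sigma> n A
        \<longrightarrow> block_pos \<tau> n (\<lambda>i j. T (A i j)))"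

definition trace_preserving :: "nat \<Rightarrow> nat \<Rightarrow> (((complex \<Rightarrow> complex) \<Rightarrow> (complex \<Rightarrow> complex))
     \<Rightarrow> ((complex \<Rightarrow> complex) \<Rightarrow> (complex \<Rightarrow> complex))) \<Rightarrow> bool" where
  "trace_preserving \<sigma> \<tau> T = (\<forall>A\<in>Bop \<sigma>. trH \<tau> (T A) = trH \<sigma> A)"

end

theory Submission
  imports Defs
begin

text \<open>
  The monomials form an orthogonal basis of \<open>H\<^sub>\<tau>\<close> with squared norms \<open>1 / (\<tau> choose i)\<close>: orthogonality
  is rotation invariance of Lebesgue measure, and the norms are Beta integrals in \<open>|z|\<^sup>2\<close>.
  Write \<open>\<mu> = a + k\<close>, \<open>\<nu> = b + k\<close>, \<open>\<tau> = a + b\<close>. Expanding the kernel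
  \<open>(z - w)\<^sup>k (1 + s z)\<^sup>a (1 + s w)\<^sup>b = \<Sum> q\<^sub>i\<^sub>j s\<^bsup>i+j-k\<^esup> z\<^sup>i w\<^sup>j\<close> turns \<open>P\<^sub>k\<close> and its adjoint into explicit
  matrices. Complete positivity follows because, expanding \<open>P\<^sub>k\<^sup>* x\<close> in powers of \<open>w\<close>, the block form of
  \<open>A \<otimes> I\<close> is a positive combination of block forms of \<open>A\<close>.

  For the trace one needs that \<open>S\<^sub>i = \<Sum>\<^sub>j q\<^sub>i\<^sub>j\<^sup>2 / ((\<tau> choose i+j-k) (\<mu> choose i) (\<nu> choose j))\<close> does not depend
  on \<open>i\<close>. Instead of Schur's lemma we use the two recurrences for \<open>q\<close> that express equivariance under the
  raising and lowering operators of \<open>sl\<^sub>2\<close>; they make \<open>S\<^sub>i\<^sub>+\<^sub>1 - S\<^sub>i\<close> telescope. The value \<open>S\<^sub>0\<close> is a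
  Vandermonde-type sum.
\<close>

subsection \<open>Moments of the measures\<close>

lemma nn_integral_lborel_translate:
  fixes f :: "'a::euclidean_space \<Rightarrow> ennreal"
  assumes [measurable]: "f \<in> borel_measurable borel"
  shows "(\<integral>\<^sup>+x. f (x + t) \<partial>lborel) = (\<integral>\<^sup>+x. f x \<partial>lborel)"
proof -
  have "(\<integral>\<^sup>+x. f x \<partial>lborel) = (\<integral>\<^sup>+x. f x \<partial>distr lborel borel (\<lambda>x. t + x))"
    using lborel_affine[of 1 t] by (simp add: density_1)
  also have "\<dots> = (\<integral>\<^sup>+x. f (x + t) \<partial>lborel)"
    by (subst nn_integral_distr) (auto simp: add.commute)
  finally show ?thesis ..
qed

lemma nn_integral_lborel_reflect:
  fixes f :: "'a::euclidean_space \<Rightarrow> ennreal"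
  assumes [measurable]: "f \<in> borel_measurable borel"
  shows "(\<integral>\<^sup>+x. f (t - x) \<partial>lborel) = (\<integral>\<^sup>+x. f x \<partial>lborel)"
proof -
  have "(\<integral>\<^sup>+x. f x \<partial>lborel) = (\<integral>\<^sup>+x. f x \<partial>distr lborel borel (\<lambda>x. t - x))"
    using lborel_affine[of "-1" t] by (simp add: density_1)
  also have "\<dots> = (\<integral>\<^sup>+x. f (t - x) \<partial>lborel)"
    by (subst nn_integral_distr) auto
  finally show ?thesis ..
qed

text \<open>Uniqueness of Haar measure: \<open>lborel\<close> and its image under the rotation are both translation invariant, so
  by Tonelli they are proportional, and they agree on the unit disc.\<close>

lemma distr_lborel_rotation:
  fixes u :: complex
  assumes u: "cmod u = 1"
  shows "distr lborel borel (\<lambda>z. u * z) = lborel"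
proof (rule measure_eqI)
  fix A :: "complex set" assume "A \<in> sets (distr lborel borel (\<lambda>z. u * z))"
  then have [measurable]: "A \<in> sets borel" by simp
  define B :: "complex set" where "B = cball 0 1"
  have [measurable]: "B \<in> sets borel" by (simp add: B_def)
  have u0: "u \<noteq> 0" using u by auto
  have inB: "u * z \<in> B \<longleftrightarrow> z \<in> B" for z using u by (simp add: B_def norm_mult)
  \<comment> \<open>The disc is rotation invariant and its measure is finite and nonzero, so it can
    be cancelled at the end.\<close>
  have cB: "emeasure lborel B = ennreal pi"
    using emeasure_cball[of 1 "0::complex"] by (simp add: B_def unit_ball_vol_2)
  have "emeasure (distr lborel borel (\<lambda>z. u * z)) A = (\<integral>\<^sup>+z. indicator A (u * z) \<partial>lborel)"
    by (subst nn_integral_indicator[symmetric]) (simp, subst nn_integral_distr, auto)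
  also have "\<dots> * emeasure lborel B
      = (\<integral>\<^sup>+z. indicator A (u * z) * (\<integral>\<^sup>+y. indicator B (y + u * z) \<partial>lborel) \<partial>lborel)"
    by (subst nn_integral_lborel_translate) (simp_all add: nn_integral_multc)
  also have "\<dots> = (\<integral>\<^sup>+z. (\<integral>\<^sup>+y. indicator A (u * z) * indicator B (u * z + y) \<partial>lborel) \<partial>lborel)"
    by (subst nn_integral_cmult) (simp_all add: add.commute)
  also have "\<dots> = (\<integral>\<^sup>+y. (\<integral>\<^sup>+z. indicator A (u * z) * indicator B (u * z + y) \<partial>lborel) \<partial>lborel)"
    by (rule lborel_pair.Fubini') simp
  \<comment> \<open>Substituting z - y / u for z moves the shift by \<open>y\<close> from
    \<open>B\<close> to \<open>A\<close>. After swapping back, the inner integral only sees a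
    reflected translate of \<open>A\<close>.\<close>
  also have "\<dots> = (\<integral>\<^sup>+y. (\<integral>\<^sup>+z. indicator A (u * z - y) * indicator B (u * z) \<partial>lborel) \<partial>lborel)"
  proof (rule nn_integral_cong)
    fix y :: complex
    show "(\<integral>\<^sup>+z. indicator A (u * z) * indicator B (u * z + y) \<partial>lborel)
        = (\<integral>\<^sup>+z. indicator A (u * z - y) * indicator B (u * z) \<partial>(lborel::complex measure))"
      using u0 by (subst nn_integral_lborel_translate[of _ "- y / u", symmetric])
        (simp_all add: right_diff_distrib)
  qed
  also have "\<dots> = (\<integral>\<^sup>+z. (\<integral>\<^sup>+y. indicator A (u * z - y) * indicator B (u * z) \<partial>lborel) \<partial>lborel)"
    by (rule lborel_pair.Fubini') simp
  also have "\<dots> = (\<integral>\<^sup>+z. emeasure lborel A * indicator B z \<partial>lborel)"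
  proof (rule nn_integral_cong)
    fix z :: complex
    show "(\<integral>\<^sup>+y. indicator A (u * z - y) * indicator B (u * z) \<partial>lborel)
        = emeasure lborel A * indicator B z"
      by (subst nn_integral_multc)
        (simp_all add: nn_integral_lborel_reflect[of "indicator A"] inB indicator_def[of B])
  qed
  also have "\<dots> = emeasure lborel A * emeasure lborel B"
    by (simp add: nn_integral_cmult)
  finally show "emeasure (distr lborel borel (\<lambda>z. u * z)) A = emeasure lborel A"
    unfolding cB by (metis mult_divide_eq_ennreal ennreal_neq_top ennreal_eq_0_iff not_le pi_gt_zero)
qed simp

section \<open>Radial integrals as Beta integrals\<close>

text \<open>Replaces polar coordinates: for t >= 0 the preimage of \<open>{..t}\<close> is the
  closed disc of radius sqrt t, of area pi t. Such half-lines form an intersection-stable generator,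
  so they determine the image measure.\<close>

lemma distr_lborel_cmod_square:
  "distr lborel borel (\<lambda>z::complex. (cmod z)\<^sup>2) = density lborel (\<lambda>t. ennreal pi * indicator {0..} t)"
proof (rule measure_eqI_generator_eq[where E = "range atMost" and \<Omega> = UNIV and A = "\<lambda>n. {..real n}"])
  show "Int_stable (range (atMost :: real \<Rightarrow> real set))"
    by (auto simp: Int_stable_def)
  have em: "emeasure (distr lborel borel (\<lambda>z::complex. (cmod z)\<^sup>2)) {..t} = ennreal (pi * max 0 t)" for t
  proof (cases "t \<ge> 0")
    case True
    then have "(\<lambda>z::complex. (cmod z)\<^sup>2) -` {..t} = cball 0 (sqrt t)"
      by (auto simp: real_le_rsqrt sqrt_ge_absD real_sqrt_le_iff' abs_le_square_iff)
    then show ?thesis using True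
      by (subst emeasure_distr) (simp_all add: emeasure_cball unit_ball_vol_2)
  next
    case False
    then have "(\<lambda>z::complex. (cmod z)\<^sup>2) -` {..t} = {}"
      by (auto simp: not_le) (smt (verit) zero_le_power2)
    then show ?thesis using False
      by (subst emeasure_distr) simp_all
  qed
  show "emeasure (distr lborel borel (\<lambda>z::complex. (cmod z)\<^sup>2)) {..real i} \<noteq> \<infinity>" for i
    by (simp add: em)
  fix X :: "real set" assume "X \<in> range atMost"
  then obtain t where X: "X = {..t}" by auto
  have "emeasure (density lborel (\<lambda>t. ennreal pi * indicator {0..} t)) {..t}
      = (\<integral>\<^sup>+s. ennreal pi * indicator {0..t} s \<partial>lborel)"
    by (subst emeasure_density) (auto intro!: nn_integral_cong simp: indicator_def)
  also have "\<dots> = ennreal (pi * max 0 t)"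
    by (subst nn_integral_cmult) (auto simp: ennreal_mult' max_def)
  finally show "emeasure (distr lborel borel (\<lambda>z::complex. (cmod z)\<^sup>2)) X
      = emeasure (density lborel (\<lambda>t. ennreal pi * indicator {0..} t)) X"
    using em X by simp
next
  show "(\<Union>n. {..real n}) = UNIV" using real_arch_simple by auto
qed (auto simp: borel_eq_atMost)

lemma nn_integral_cmod_square:
  fixes f :: "real \<Rightarrow> ennreal"
  assumes [measurable]: "f \<in> borel_measurable borel"
  shows "(\<integral>\<^sup>+z. f ((cmod z)\<^sup>2) \<partial>lborel) = ennreal pi * (\<integral>\<^sup>+t. f t * indicator {0..} t \<partial>lborel)"
proof -
  have "(\<integral>\<^sup>+z. f ((cmod z)\<^sup>2) \<partial>lborel) = (\<integral>\<^sup>+t. f t \<partial>distr lborel borel (\<lambda>z::complex. (cmod z)\<^sup>2))"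
    by (subst nn_integral_distr) auto
  also have "\<dots> = (\<integral>\<^sup>+t. ennreal pi * (f t * indicator {0..} t) \<partial>lborel)"
    unfolding distr_lborel_cmod_square by (subst nn_integral_density) (auto simp: mult_ac)
  also have "\<dots> = ennreal pi * (\<integral>\<^sup>+t. f t * indicator {0..} t \<partial>lborel)"
    by (rule nn_integral_cmult) auto
  finally show ?thesis .
qed

text \<open>The Beta integral B(i + 1, d + 1). Writing 1 = 1 / (1 + t) + t / (1 + t) in the
  integrand expresses the value at (i, Suc d) through those at (i, d) and (Suc i, d), so induction
  on \<open>d\<close> with \<open>i\<close> arbitrary works.\<close>

lemma nn_integral_power_over_power:
  "(\<integral>\<^sup>+t. ennreal (t ^ i / (1 + t) ^ (i + d + 2)) * indicator {0..} t \<partial>lborel)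
    = ennreal (fact i * fact d / fact (i + d + 1))"
proof (induction d arbitrary: i)
  case 0
  \<comment> \<open>An antiderivative of the integrand, since t / (1 + t) has derivative 1 / (1 +
    t)^2; its limit at infinity is 1 / (i + 1).\<close>
  define F where "F t = (t / (1 + t)) ^ (i + 1) / real (i + 1)" for t :: real
  have "(\<integral>\<^sup>+t. ennreal (t ^ i / (1 + t) ^ (i + 2)) * indicator {0..} t \<partial>lborel)
      = ennreal (1 / real (i + 1) - F 0)"
  proof (rule nn_integral_FTC_atLeast)
    fix t :: real assume t: "0 \<le> t"
    have "((\<lambda>t. t / (1 + t)) has_real_derivative 1 / (1 + t)\<^sup>2) (at t)"
      using t by (auto intro!: derivative_eq_intros simp: power2_eq_square)
    from DERIV_power[OF this, of "i + 1"]
    have "(F has_real_derivative (real (i + 1) * (t / (1 + t)) ^ i * (1 / (1 + t)\<^sup>2)) / real (i + 1)) (at t)"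
      unfolding F_def by (intro DERIV_cdivide) (simp add: mult_ac)
    also have "(real (i + 1) * (t / (1 + t)) ^ i * (1 / (1 + t)\<^sup>2)) / real (i + 1) = t ^ i / (1 + t) ^ (i + 2)"
      by (simp add: power_divide power_add power2_eq_square)
    finally show "(F has_real_derivative t ^ i / (1 + t) ^ (i + 2)) (at t)" .
    show "0 \<le> t ^ i / (1 + t) ^ (i + 2)" using t by simp
  next
    have "((\<lambda>t::real. 1 - inverse (1 + t)) \<longlongrightarrow> 1 - 0) at_top"
      by (intro tendsto_intros tendsto_inverse_0_at_top filterlim_tendsto_add_at_top[OF tendsto_const] filterlim_ident)
    moreover have "\<forall>\<^sub>F t::real in at_top. 1 - inverse (1 + t) = t / (1 + t)"
      using eventually_ge_at_top[of 0] by eventually_elim (simp add: field_simps)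
    ultimately have "((\<lambda>t::real. t / (1 + t)) \<longlongrightarrow> 1) at_top"
      by (simp add: tendsto_cong)
    then have "((\<lambda>t::real. (t / (1 + t)) ^ (i + 1) / real (i + 1)) \<longlongrightarrow> 1 ^ (i + 1) / real (i + 1)) at_top"
      by (intro tendsto_intros) auto
    then show "(F \<longlongrightarrow> 1 / real (i + 1)) at_top" unfolding F_def power_one .
  qed simp
  moreover have "1 / real (i + 1) - F 0 = fact i * fact 0 / fact (i + 0 + 1)"
    by (simp add: F_def divide_simps)
  ultimately show ?case by (simp only: add_0_right)
next
  case (Suc d)
  let ?G = "\<lambda>i d. (\<integral>\<^sup>+t. ennreal (t ^ i / (1 + t) ^ (i + d + 2)) * indicator {0..} t \<partial>lborel)"
  have "?G i d = (\<integral>\<^sup>+t. ennreal (t ^ i / (1 + t) ^ (i + Suc d + 2)) * indicator {0..} t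
          + ennreal (t ^ Suc i / (1 + t) ^ (Suc i + d + 2)) * indicator {0..} t \<partial>lborel)"
  proof (rule nn_integral_cong)
    fix t :: real
    have "t ^ i / (1 + t) ^ (i + d + 2)
        = t ^ i / (1 + t) ^ (i + Suc d + 2) + t ^ Suc i / (1 + t) ^ (Suc i + d + 2)" if "t \<ge> 0"
      using that by (simp add: divide_simps) (simp add: algebra_simps)
    then show "ennreal (t ^ i / (1 + t) ^ (i + d + 2)) * indicator {0..} t =
        ennreal (t ^ i / (1 + t) ^ (i + Suc d + 2)) * indicator {0..} t
          + ennreal (t ^ Suc i / (1 + t) ^ (Suc i + d + 2)) * indicator {0..} t"
      by (auto simp: indicator_def ennreal_plus[symmetric] simp del: ennreal_plus)
  qed
  also have "\<dots> = ?G i (Suc d) + ?G (Suc i) d"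
    by (rule nn_integral_add) auto
  finally have "ennreal (fact i * fact d / fact (i + d + 1))
      = ?G i (Suc d) + ennreal (fact (Suc i) * fact d / fact (Suc i + d + 1))"
    unfolding Suc.IH .
  moreover have "fact i * fact d / fact (i + d + 1)
      = fact i * fact (Suc d) / fact (i + Suc d + 1) + (fact (Suc i) * fact d / fact (Suc i + d + 1) :: real)"
    by (simp add: divide_simps) (simp add: algebra_simps)
  ultimately have "?G i (Suc d) + ennreal (fact (Suc i) * fact d / fact (Suc i + d + 1))
      = ennreal (fact i * fact (Suc d) / fact (i + Suc d + 1)) + ennreal (fact (Suc i) * fact d / fact (Suc i + d + 1))"
    by (simp add: ennreal_plus[symmetric] del: ennreal_plus fact_Suc)
  \<comment> \<open>Cancellation in \<open>ennreal\<close> is legitimate because the common summand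
    is finite.\<close>
  then show ?case
    unfolding add.commute[of _ "ennreal (fact (Suc i) * fact d / fact (Suc i + d + 1))"]
      ennreal_add_left_cancel by (simp only: infinity_ennreal_def ennreal_neq_top simp_thms)
qed

text \<open>The Beta integral with d = \<tau> - i gives i! d! / (\<tau> + 1)!, and the factor \<tau>
  + 1 of the density turns this into the reciprocal binomial coefficient.\<close>

lemma has_bochner_integral_cmod_power_dens:
  assumes "i \<le> \<tau>"
  shows "has_bochner_integral lborel
    (\<lambda>z. (real \<tau> + 1) / (pi * (1 + (cmod z)\<^sup>2) ^ (\<tau> + 2)) * ((cmod z)\<^sup>2) ^ i) (1 / real (\<tau> choose i))"
proof (rule has_bochner_integral_nn_integral)
  define d where "d = \<tau> - i"
  have \<tau>: "\<tau> = i + d" using assms by (simp add: d_def)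
  let ?c = "ennreal ((real \<tau> + 1) / pi)"
  have "(\<integral>\<^sup>+z. ennreal ((real \<tau> + 1) / (pi * (1 + (cmod z)\<^sup>2) ^ (\<tau> + 2)) * ((cmod z)\<^sup>2) ^ i) \<partial>lborel)
    = (\<integral>\<^sup>+z. ?c * ennreal (((cmod z)\<^sup>2) ^ i / (1 + (cmod z)\<^sup>2) ^ (i + d + 2)) \<partial>lborel)"
    by (intro nn_integral_cong) (simp add: \<tau> ennreal_mult'[symmetric])
  also have "\<dots> = ?c * (\<integral>\<^sup>+z. ennreal (((cmod z)\<^sup>2) ^ i / (1 + (cmod z)\<^sup>2) ^ (i + d + 2)) \<partial>lborel)"
    by (rule nn_integral_cmult) auto
  also have "\<dots> = ?c * (ennreal pi * ennreal (fact i * fact d / fact (i + d + 1)))"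
    by (subst nn_integral_cmod_square[where f = "\<lambda>t. ennreal (t ^ i / (1 + t) ^ (i + d + 2))"])
      (simp_all only: nn_integral_power_over_power, measurable)
  also have "\<dots> = ennreal ((real \<tau> + 1) / pi * (pi * (fact i * fact d / fact (i + d + 1))))"
    by (simp add: ennreal_mult'[symmetric] del: fact_Suc)
  also have "(real \<tau> + 1) / pi * (pi * (fact i * fact d / fact (i + d + 1))) = 1 / real (\<tau> choose i)"
    using binomial_fact[OF assms, where 'a = real] by (simp add: \<tau> divide_simps ac_simps)
  finally show "(\<integral>\<^sup>+z. ennreal ((real \<tau> + 1) / (pi * (1 + (cmod z)\<^sup>2) ^ (\<tau> + 2)) * ((cmod z)\<^sup>2) ^ i) \<partial>lborel)
      = ennreal (1 / real (\<tau> choose i))" .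
qed (auto intro!: divide_nonneg_nonneg mult_nonneg_nonneg)

section \<open>Orthogonality of the monomials\<close>

lemma borel_measurable_dens [measurable]: "dens \<tau> \<in> borel_measurable borel"
  unfolding dens_def by measurable

lemma borel_measurable_cnj [measurable]: "cnj \<in> borel_measurable borel"
  by (intro borel_measurable_continuous_onI continuous_intros)

text \<open>The product |z|^i |z|^j is dominated by |z|^(2i) + |z|^(2j), whose two terms are already
  known to be integrable.\<close>

lemma integrable_monomials_dens:
  assumes "i \<le> \<tau>" "j \<le> \<tau>"
  shows "integrable lborel (\<lambda>z. z ^ i * cnj z ^ j * dens \<tau> z)"
proof (rule Bochner_Integration.integrable_bound)
  let ?w = "\<lambda>z. (real \<tau> + 1) / (pi * (1 + (cmod z)\<^sup>2) ^ (\<tau> + 2))"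
  show "integrable lborel (\<lambda>z. ?w z * ((cmod z)\<^sup>2) ^ i + ?w z * ((cmod z)\<^sup>2) ^ j)"
    using assms[THEN has_bochner_integral_cmod_power_dens] 
    by (intro Bochner_Integration.integrable_add) (auto simp: has_bochner_integral_iff)
  show "AE z in lborel. norm (z ^ i * cnj z ^ j * dens \<tau> z)
      \<le> norm (?w z * ((cmod z)\<^sup>2) ^ i + ?w z * ((cmod z)\<^sup>2) ^ j)"
  proof (rule AE_I2)
    fix z :: complex
    let ?a = "cmod z ^ i" and ?b = "cmod z ^ j"
    have w: "?w z \<ge> 0" by simp
    have "2 * (?a * ?b) \<le> ?a\<^sup>2 + ?b\<^sup>2"
      using sum_squares_bound[of ?a ?b] by simp
    moreover have "?a * ?b \<ge> 0" by simp
    ultimately have "?a * ?b \<le> ?a\<^sup>2 + ?b\<^sup>2" by linarith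
    then have "?w z * (?a * ?b) \<le> ?w z * (?a\<^sup>2 + ?b\<^sup>2)"
      by (rule mult_left_mono[OF _ w])
    moreover have "norm (z ^ i * cnj z ^ j * dens \<tau> z) = ?w z * (?a * ?b)"
      unfolding dens_def norm_mult norm_of_real abs_of_nonneg[OF w] by (simp add: norm_power)
    moreover have "norm (?w z * ((cmod z)\<^sup>2) ^ i + ?w z * ((cmod z)\<^sup>2) ^ j) = ?w z * (?a\<^sup>2 + ?b\<^sup>2)"
      using w by (simp add: power_mult[symmetric] mult.commute[of 2] distrib_left flip: power_mult)
    ultimately show "norm (z ^ i * cnj z ^ j * dens \<tau> z)
      \<le> norm (?w z * ((cmod z)\<^sup>2) ^ i + ?w z * ((cmod z)\<^sup>2) ^ j)" by simp
  qed
qed auto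

lemma integral_monomials_dens:
  assumes "i \<le> \<tau>" "j \<le> \<tau>"
  shows "(\<integral>z. z ^ i * cnj z ^ j * dens \<tau> z \<partial>lborel) = (if i = j then 1 / of_nat (\<tau> choose i) else 0)"
proof (cases "i = j")
  case True
  have "z ^ j * cnj z ^ j * dens \<tau> z = complex_of_real
      ((real \<tau> + 1) / (pi * (1 + (cmod z)\<^sup>2) ^ (\<tau> + 2)) * ((cmod z)\<^sup>2) ^ j)" for z
    unfolding dens_def of_real_mult of_real_power[of _ j] complex_norm_square power_mult_distrib
    by (simp only: mult.commute)
  then show ?thesis
    using has_bochner_integral_cmod_power_dens[OF assms(2)] True
    by (simp only: has_bochner_integral_iff integral_complex_of_real) simp
next
  case False
  define I where "I = (\<integral>z. z ^ i * cnj z ^ j * dens \<tau> z \<partial>lborel)"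
  \<comment> \<open>The angle is chosen so that rotation by \<open>u\<close> multiplies the
    integrand by cis pi = -1; rotation invariance then gives I = -I.\<close>
  define \<theta> where "\<theta> = pi / (real i - real j)"
  define u where "u = cis \<theta>"
  have "u ^ i * cnj u ^ j = cis (real i * \<theta> - real j * \<theta>)"
    by (simp add: u_def Complex.DeMoivre cis_cnj cis_mult)
  also have "real i * \<theta> - real j * \<theta> = pi"
    using False by (simp add: \<theta>_def flip: left_diff_distrib diff_divide_distrib)
  finally have u: "u ^ i * cnj u ^ j = -1" by simp
  have cu: "cmod u = 1" by (simp add: u_def)
  have "I = (\<integral>z. z ^ i * cnj z ^ j * dens \<tau> z \<partial>distr lborel borel (\<lambda>z. u * z))"
    by (simp only: I_def distr_lborel_rotation[OF cu])
  also have "\<dots> = (\<integral>z. (u * z) ^ i * cnj (u * z) ^ j * dens \<tau> (u * z) \<partial>lborel)"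
    by (rule integral_distr) measurable
  also have "\<dots> = (\<integral>z. (u ^ i * cnj u ^ j) * (z ^ i * cnj z ^ j * dens \<tau> z) \<partial>lborel)"
    using cu by (simp add: dens_def norm_mult power_mult_distrib mult_ac)
  also have "\<dots> = - I" by (simp add: u I_def)
  finally show ?thesis using False by (simp add: I_def)
qed

subsection \<open>Coefficients of the kernel\<close>

text \<open>\<open>cg k a b i j\<close> is the coefficient of \<open>z\<^sup>i w\<^sup>j\<close> in \<open>(z - w)\<^sup>k (1 + z)\<^sup>a (1 + w)\<^sup>b\<close>. Integer indices make the
  recurrences hold without boundary cases.\<close>

fun cg :: "nat \<Rightarrow> nat \<Rightarrow> nat \<Rightarrow> int \<Rightarrow> int \<Rightarrow> real" where
  "cg (Suc k) a b = (\<lambda>i j. cg k a b (i - 1) j - cg k a b i (j - 1))"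
| "cg 0 (Suc a) b = (\<lambda>i j. cg 0 a b i j + cg 0 a b (i - 1) j)"
| "cg 0 0 (Suc b) = (\<lambda>i j. cg 0 0 b i j + cg 0 0 b i (j - 1))"
| "cg 0 0 0 = (\<lambda>i j. if i = 0 \<and> j = 0 then 1 else 0)"

text \<open>Degree bounds in z, in w and in total degree, the lower bound coming from the
  homogeneous factor (z - w)^k. They justify every later truncation of sums and every natural-number
  subtraction i + j - k.\<close>

lemma cg_support:
  assumes "cg k a b i j \<noteq> 0"
  shows "0 \<le> i \<and> i \<le> int (a + k) \<and> 0 \<le> j \<and> j \<le> int (b + k) \<and> int k \<le> i + j \<and> i + j \<le> int (k + a + b)"
  using assms
proof (induction k a b arbitrary: i j rule: cg.induct)
  case (1 k a b)
  then have "cg k a b (i - 1) j \<noteq> 0 \<or> cg k a b i (j - 1) \<noteq> 0" by auto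
  then show ?case using "1.IH"[of "i - 1" j] "1.IH"[of i "j - 1"] by auto
next
  case (2 a b)
  then have "cg 0 a b i j \<noteq> 0 \<or> cg 0 a b (i - 1) j \<noteq> 0" by auto
  then show ?case using "2.IH"[of "i - 1" j] "2.IH"[of i j] by auto
next
  case (3 b)
  then have "cg 0 0 b i j \<noteq> 0 \<or> cg 0 0 b i (j - 1) \<noteq> 0" by auto
  then show ?case using "3.IH"[of i "j - 1"] "3.IH"[of i j] by auto
qed (auto split: if_splits)

text \<open>The factors \<open>z - w\<close>, \<open>1 + z\<close>, \<open>1 + w\<close> are eigenvectors of the derivation \<open>(1 + z)\<partial>\<^sub>z + (1 + w)\<partial>\<^sub>w\<close>
  with eigenvalue 1.\<close>

lemma cg_lowering:
  "(of_int i + 1) * cg k a b (i + 1) j + (of_int j + 1) * cg k a b i (j + 1)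
    = (real k + real a + real b - of_int i - of_int j) * cg k a b i j"
proof (induction k a b arbitrary: i j rule: cg.induct)
  case (1 k a b)
  show ?case using "1.IH"[of "i - 1" j] "1.IH"[of i "j - 1"] by (simp add: algebra_simps)
next
  case (2 a b)
  show ?case using "2.IH"[of "i - 1" j] "2.IH"[of i j] by (simp add: algebra_simps)
next
  case (3 b)
  show ?case using "3.IH"[of i "j - 1"] "3.IH"[of i j] by (simp add: algebra_simps)
next
  case 4
  then show ?case by (auto simp: add_eq_0_iff2)
qed

text \<open>The same for the derivation \<open>z(1 + z)\<partial>\<^sub>z + w(1 + w)\<partial>\<^sub>w\<close>, with multipliers \<open>1 + z + w\<close>, \<open>z\<close>, \<open>w\<close>.\<close>

lemma cg_raising:
  "(real a + real k - of_int i + 1) * cg k a b (i - 1) j + (real b + real k - of_int j + 1) * cg k a b i (j - 1)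
    = (of_int i + of_int j - real k) * cg k a b i j"
proof (induction k a b arbitrary: i j rule: cg.induct)
  case (1 k a b)
  show ?case using "1.IH"[of "i - 1" j] "1.IH"[of i "j - 1"] by (simp add: algebra_simps)
next
  case (2 a b)
  show ?case using "2.IH"[of "i - 1" j] "2.IH"[of i j] by (simp add: algebra_simps)
next
  case (3 b)
  show ?case using "3.IH"[of i "j - 1"] "3.IH"[of i j] by (simp add: algebra_simps)
next
  case 4
  then show ?case by auto
qed

text \<open>At z = 0 the kernel reduces to (-w)^k (1 + w)^b.\<close>

lemma cg_first_row: "cg k a b 0 (int (k + l)) = (-1) ^ k * real (b choose l)"
proof (induction k a b arbitrary: l rule: cg.induct)
  case (1 k a b)
  have "cg k a b (-1) j = 0" for j using cg_support[of k a b "-1" j] by auto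
  then show ?case using 1[of l] by simp
next
  case (2 a b)
  have "cg 0 a b (-1) j = 0" for j using cg_support[of 0 a b "-1" j] by auto
  then show ?case using 2[of l] by simp
next
  case (3 b)
  have z: "cg 0 0 b 0 (-1) = 0" using cg_support[of 0 0 b 0 "-1"] by auto
  show ?case
  proof (cases l)
    case 0
    then show ?thesis using 3[of 0] z by simp
  next
    case (Suc l')
    then show ?thesis using 3[of l] 3[of l'] by simp
  qed
qed (auto)

section \<open>Row sums of the squared kernel coefficients\<close>

text \<open>Compares the coefficients of x^n in (1 - x)^(-k-1) (1 - x)^(-p-1) = (1 - x)^(-k-p-2);
  proved by Pascal's rule, with the hockey-stick sum as the case p = 0.\<close>

lemma sum_choose_mult_choose:
  "(\<Sum>l\<le>n. (l + k choose k) * (n - l + p choose p)) = (n + k + p + 1 choose (k + p + 1))"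
proof (induction "n + p" arbitrary: n p)
  case 0
  then show ?case by simp
next
  case (Suc x)
  show ?case
  proof (cases p)
    case 0
    have "(\<Sum>l\<le>n. (l + k choose k)) = (n + k + 1 choose (k + 1))"
      by (induction n) auto
    then show ?thesis using 0 by simp
  next
    case p: (Suc p')
    show ?thesis
    proof (cases n)
      case n: (Suc n')
      \<comment> \<open>Pascal's rule splits the second factor for \<open>l \<le> n'\<close>; the
        remaining term \<open>l = n\<close> completes the sum belonging to
        \<open>p'\<close>.\<close>
      have "(\<Sum>l\<le>n. (l + k choose k) * (n - l + p choose p))
        = (\<Sum>l\<le>n'. (l + k choose k) * (n' - l + p choose p) + (l + k choose k) * (n - l + p' choose p')) + (n + k choose k)"
        by (simp add: n p algebra_simps Suc_diff_le)
      also have "\<dots> = (\<Sum>l\<le>n'. (l + k choose k) * (n' - l + p choose p))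
          + (\<Sum>l\<le>n. (l + k choose k) * (n - l + p' choose p'))"
        by (simp add: n sum.distrib)
      also have "\<dots> = (n' + k + p + 1 choose (k + p + 1)) + (n + k + p' + 1 choose (k + p' + 1))"
        using Suc.hyps(1)[of n' p] Suc.hyps(1)[of n p'] Suc.hyps(2) n p by simp
      also have "\<dots> = (n + k + p + 1 choose (k + p + 1))"
        by (simp add: n p)
      finally show ?thesis .
    qed (simp add: p)
  qed
qed

text \<open>Up to the factor \<open>Ck\<close> squared, this is the squared Clebsch-Gordan
  coefficient with respect to the normalised monomials. Its sum over \<open>j\<close> is the
  quantity \<open>S\<^sub>i\<close> of the overview.\<close>

definition cg_weight :: "nat \<Rightarrow> nat \<Rightarrow> nat \<Rightarrow> nat \<Rightarrow> nat \<Rightarrow> real" where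
  "cg_weight k a b i j = (cg k a b (int i) (int j))\<^sup>2
     / (real (a + b choose (i + j - k)) * real (a + k choose i) * real (b + k choose j))"

lemma choose_Suc_mult: "real (Suc j) * real (n choose Suc j) = (real n - real j) * real (n choose j)"
proof (cases "j \<le> n")
  case True
  have "Suc j * (n choose Suc j) = (n - j) * (n choose j)"
    by (simp only: binomial_absorption binomial_absorb_comp)
  then have "real (Suc j * (n choose Suc j)) = real ((n - j) * (n choose j))" by (simp only:)
  then show ?thesis using True by (simp only: of_nat_mult of_nat_diff)
qed (simp add: binomial_eq_0)

text \<open>After scaling by \<open>c\<close>, the lowering recurrence writes row
  \<open>Suc i\<close> as D j - E j, and the raising recurrence writes row \<open>i\<close> at
  \<open>Suc j\<close> as D (Suc j) - E j. The two sums over \<open>j\<close> then agree up to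
  boundary terms, which vanish.\<close>

lemma sum_cg_weight_Suc:
  assumes i: "i < a + k"
  shows "(\<Sum>j\<le>b + k. cg_weight k a b (Suc i) j) = (\<Sum>j\<le>b + k. cg_weight k a b i j)"
proof -
  define q where "q i j = cg k a b (int i) (int j)" for i j
  let ?\<mu> = "a + k" and ?\<nu> = "b + k" and ?\<tau> = "a + b"
  define c where "c = (real ?\<mu> - real i) * real (?\<mu> choose i)"
  define D where "D j = (real i + real j + 1 - real k) * q i j * q (Suc i) j
      / (real (?\<tau> choose (i + j - k)) * real (?\<nu> choose j))" for j
  define E where "E j = (real j + 1) * q i (Suc j) * q (Suc i) j
      / (real (?\<tau> choose (Suc i + j - k)) * real (?\<nu> choose j))" for j
  \<comment> \<open>Binomial absorption gives \<open>c\<close> two forms: the defining one cancels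
    the \<mu>-binomial of row \<open>i\<close>, the other that of row \<open>Suc i\<close>.\<close>
  have c0: "c \<noteq> 0" using i by (simp add: c_def)
  have c': "c = real (Suc i) * real (?\<mu> choose Suc i)"
    unfolding c_def by (rule choose_Suc_mult[symmetric])
  have X: "c * cg_weight k a b (Suc i) j = D j - E j" if "j \<le> ?\<nu>" for j
  proof (cases "q (Suc i) j = 0")
    case True
    then show ?thesis by (simp add: cg_weight_def D_def E_def q_def)
  next
    case False
    then have s: "k \<le> Suc i + j" "Suc i + j \<le> k + a + b"
      using cg_support[of k a b "int (Suc i)" "int j"] by (auto simp: q_def)
    have R: "(real i + 1) * q (Suc i) j + (real j + 1) * q i (Suc j) = (real k + real a + real b - real i - real j) * q i j"
      using cg_lowering[of "int i" k a b "int j"] by (simp add: q_def add.commute)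
    have "c * cg_weight k a b (Suc i) j = (real i + 1) * q (Suc i) j * q (Suc i) j
        / (real (?\<tau> choose (Suc i + j - k)) * real (?\<nu> choose j))"
      unfolding c' using i by (simp add: cg_weight_def q_def power2_eq_square)
    also have "(real i + 1) * q (Suc i) j
        = (real k + real a + real b - real i - real j) * q i j - (real j + 1) * q i (Suc j)"
      using R by simp
    also have "(\<dots> * q (Suc i) j / (real (?\<tau> choose (Suc i + j - k)) * real (?\<nu> choose j))) = 
       (real k + real a + real b - real i - real j) * q i j * q (Suc i) j / (real (?\<tau> choose (Suc i + j - k)) * real (?\<nu> choose j)) - E j"
      by (simp add: E_def left_diff_distrib diff_divide_distrib)
    \<comment> \<open>Absorption trades the \<tau>-binomial at i + j + 1 - k for the one at i + j -
      k. When i + j < k the subtraction truncates to 0, but then \<open>q i j\<close>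
      vanishes.\<close>
    also have "(real k + real a + real b - real i - real j) * q i j * q (Suc i) j / (real (?\<tau> choose (Suc i + j - k)) * real (?\<nu> choose j)) = D j"
    proof (cases "k \<le> i + j")
      case True
      then obtain m where m: "i + j = k + m" using le_Suc_ex by blast
      have "?\<tau> choose Suc m > 0" "?\<tau> choose m > 0" using s m by auto
      then have C: "(real ?\<tau> - real m) / real (?\<tau> choose Suc m) = real (Suc m) / real (?\<tau> choose m)"
        using choose_Suc_mult[of m ?\<tau>] by (subst frac_eq_eq) auto
      have e: "Suc i + j - k = Suc m" "i + j - k = m" "real i + real j + 1 - real k = real (Suc m)"
        "real k + real a + real b - real i - real j = real ?\<tau> - real m" using m by linarith+
      have *: "x * q i j * q (Suc i) j / (y * real (?\<nu> choose j)) = x / y * (q i j * q (Suc i) j / real (?\<nu> choose j))" for x y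
        by simp
      show ?thesis unfolding D_def e * C ..
    next
      case False
      then have "q i j = 0" using cg_support[of k a b "int i" "int j"] by (auto simp: q_def)
      then show ?thesis by (simp add: D_def)
    qed
    finally show ?thesis .
  qed
  have Y: "c * cg_weight k a b i (Suc j) = D (Suc j) - E j" if "j < ?\<nu>" for j
  proof -
    have R: "(real ?\<mu> - real i) * q i (Suc j) + (real ?\<nu> - real j) * q (Suc i) j
        = (real i + real (Suc j) + 1 - real k) * q (Suc i) (Suc j)"
      using cg_raising[of a k "int (Suc i)" b "int (Suc j)"] by (simp add: q_def algebra_simps)
    \<comment> \<open>Absorption in the \<nu>-binomial rewrites \<open>E j\<close> over the
      denominators of the weight at \<open>Suc j\<close>.\<close>
    have "(real ?\<nu> - real j) * real (?\<nu> choose j) = (real j + 1) * real (?\<nu> choose Suc j)"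
      using choose_Suc_mult[of j ?\<nu>] by (simp add: add.commute)
    then have E: "E j = (real ?\<nu> - real j) * q (Suc i) j * q i (Suc j) / (real (?\<tau> choose (i + Suc j - k)) * real (?\<nu> choose Suc j))"
      using that unfolding E_def by (simp add: divide_simps)
    have "c * cg_weight k a b i (Suc j) = (real ?\<mu> - real i) * q i (Suc j) * q i (Suc j)
        / (real (?\<tau> choose (i + Suc j - k)) * real (?\<nu> choose Suc j))"
      unfolding c_def using i by (simp add: cg_weight_def q_def power2_eq_square)
    also have "(real ?\<mu> - real i) * q i (Suc j)
        = (real i + real (Suc j) + 1 - real k) * q (Suc i) (Suc j) - (real ?\<nu> - real j) * q (Suc i) j"
      using R by simp
    also have "\<dots> * q i (Suc j) / (real (?\<tau> choose (i + Suc j - k)) * real (?\<nu> choose Suc j)) = D (Suc j) - E j"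
      unfolding E D_def left_diff_distrib diff_divide_distrib by (simp only: mult_ac)
    finally show ?thesis .
  qed
  \<comment> \<open>At the lower boundary the \<open>E\<close>-type term would involve column -1,
    outside the support; at the upper one \<open>E\<close> involves column \<nu> + 1.\<close>
  have Y0: "c * cg_weight k a b i 0 = D 0"
  proof -
    have "cg k a b (1 + int i) (- 1) = 0" using cg_support[of k a b "1 + int i" "- 1"] by auto
    then have R: "(real ?\<mu> - real i) * q i 0 = (real i + 1 - real k) * q (Suc i) 0"
      using cg_raising[of a k "int (Suc i)" b 0] by (simp add: q_def algebra_simps)
    have "c * cg_weight k a b i 0 = (real ?\<mu> - real i) * q i 0 * q i 0 / real (?\<tau> choose (i - k))"
      unfolding c_def using i by (simp add: cg_weight_def q_def power2_eq_square)
    then show ?thesis unfolding R D_def by simp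
  qed
  have E0: "E ?\<nu> = 0"
    using cg_support[of k a b "int i" "int (Suc ?\<nu>)"] by (auto simp: E_def q_def)
  have "c * (\<Sum>j\<le>?\<nu>. cg_weight k a b (Suc i) j) = (\<Sum>j\<le>?\<nu>. D j - E j)"
    using X by (simp add: sum_distrib_left)
  also have "\<dots> = (\<Sum>j<Suc ?\<nu>. D j) - (\<Sum>j<Suc ?\<nu>. E j)"
    by (simp only: sum_subtractf lessThan_Suc_atMost)
  also have "\<dots> = D 0 + (\<Sum>j<?\<nu>. D (Suc j) - E j)"
    unfolding sum.lessThan_Suc_shift[of D] sum.lessThan_Suc[of E] E0 sum_subtractf by simp
  also have "\<dots> = (\<Sum>j<Suc ?\<nu>. c * cg_weight k a b i j)"
    unfolding sum.lessThan_Suc_shift using Y Y0 by simp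
  also have "\<dots> = c * (\<Sum>j\<le>?\<nu>. cg_weight k a b i j)"
    by (simp only: sum_distrib_left lessThan_Suc_atMost)
  finally show ?thesis using c0 by simp
qed

text \<open>Row 0 is explicit, and its quotients of binomials rearrange into a constant times the
  summand of \<open>sum_choose_mult_choose\<close>.\<close>

lemma sum_cg_weight_0:
  "(\<Sum>j\<le>b + k. cg_weight k a b 0 j)
    = (fact b)\<^sup>2 * fact k * fact a / (fact (b + k) * fact (a + b)) * real (a + b + k + 1 choose (a + k + 1))"
proof -
  have "(\<Sum>j\<le>b + k. cg_weight k a b 0 j) = (\<Sum>j\<in>{k..b + k}. cg_weight k a b 0 j)"
  proof (rule sum.mono_neutral_right)
    have "cg k a b 0 (int j) = 0" if "j < k" for j
      using cg_support[of k a b 0 "int j"] that by auto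
    then show "\<forall>j\<in>{..b + k} - {k..b + k}. cg_weight k a b 0 j = 0"
      by (auto simp: cg_weight_def)
  qed auto
  also have "\<dots> = (\<Sum>l\<le>b. cg_weight k a b 0 (l + k))"
    using sum.shift_bounds_cl_nat_ivl[of "cg_weight k a b 0" 0 k b] by (simp add: atLeast0AtMost)
  also have "\<dots> = (\<Sum>l\<le>b. (fact b)\<^sup>2 * fact k * fact a / (fact (b + k) * fact (a + b))
      * real ((l + k choose k) * (b - l + a choose a)))"
  proof (rule sum.cong)
    fix l assume "l \<in> {..b}"
    then obtain c where b: "b = l + c" by (auto simp: le_iff_add)
    have "cg_weight k a b 0 (l + k) = (real (b choose l))\<^sup>2 / (real (a + b choose l) * real (b + k choose (l + k)))"
      using cg_first_row[of k a b l] by (simp add: cg_weight_def add.commute power_mult_distrib flip: power_mult)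
    also have "\<dots> = (fact b)\<^sup>2 * fact k * fact a / (fact (b + k) * fact (a + b))
      * real ((l + k choose k) * (b - l + a choose a))"
      by (simp add: b binomial_fact divide_simps power2_eq_square add_ac)
    finally show "cg_weight k a b 0 (l + k) = (fact b)\<^sup>2 * fact k * fact a / (fact (b + k) * fact (a + b))
      * real ((l + k choose k) * (b - l + a choose a))" .
  qed simp
  also have "\<dots> = (fact b)\<^sup>2 * fact k * fact a / (fact (b + k) * fact (a + b)) * real (\<Sum>l\<le>b. (l + k choose k) * (b - l + a choose a))"
    by (simp add: sum_distrib_left)
  finally show ?thesis unfolding sum_choose_mult_choose by (simp only: add_ac)
qed

section \<open>The normalising constant of P_k\<close>

lemma pochhammer_of_nat_Suc: "pochhammer (real (Suc n)) k = fact (n + k) / fact n"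
proof (induction k)
  case (Suc k)
  then show ?case unfolding pochhammer_Suc by (simp add: add.commute)
qed simp

text \<open>The signs (-1)^k of the two Pochhammer symbols at negative arguments cancel, so the
  radicand is a nonnegative quotient of factorials and the square root can be undone.\<close>

lemma Ck_square:
  "(Ck (a + k) (b + k) k)\<^sup>2
    = fact (a + k) * fact (b + k) * fact (a + b + 1) / (fact a * fact b * fact k * fact (a + b + k + 1))"
proof -
  have m: "pochhammer (- real (n + k)) k = (-1) ^ k * (fact (n + k) / fact n)" for n
    using pochhammer_minus[of "real (n + k)" k] pochhammer_of_nat_Suc[of n k] by (simp add: add.commute)
  have e: "a + k + (b + k) - 2 * k + 2 = Suc (a + b + 1)" by simp
  have "pochhammer (- real (b + k)) k * pochhammer (- real (a + k)) k / (fact k * pochhammer (real (Suc (a + b + 1))) k)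
      = fact (a + k) * fact (b + k) * fact (a + b + 1) / (fact a * fact b * fact k * fact (a + b + k + 1))"
    unfolding m pochhammer_of_nat_Suc
    by (simp add: divide_simps add_ac del: fact_Suc) 
  then show ?thesis unfolding Ck_def e
    by (simp del: fact_Suc)
qed

text \<open>The left side is a diagonal entry of the partial trace of P_k^* P_k over H_\<nu>. Its
  value is the ratio of dimensions, computed in row 0 and carried along by
  \<open>sum_cg_weight_Suc\<close>.\<close>

lemma Ck_square_sum_cg_weight:
  assumes "i \<le> a + k"
  shows "(Ck (a + k) (b + k) k)\<^sup>2 * (\<Sum>j\<le>b + k. cg_weight k a b i j) = (real (a + b) + 1) / (real (a + k) + 1)"
  using assms
proof (induction i)
  case 0
  have "real (a + b + k + 1 choose (a + k + 1)) = fact (a + b + k + 1) / (fact (a + k + 1) * fact b)"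
    by (subst binomial_fact) auto
  then have "(Ck (a + k) (b + k) k)\<^sup>2 * (\<Sum>j\<le>b + k. cg_weight k a b 0 j)
      = fact (a + b + 1) / fact (a + b) * (fact (a + k) / fact (a + k + 1))"
    unfolding Ck_square sum_cg_weight_0 by (simp add: divide_simps power2_eq_square mult_ac del: fact_Suc)
  also have "\<dots> = (real (a + b) + 1) / (real (a + k) + 1)"
    by (simp add: divide_simps add_ac)
  finally show ?case .
next
  case (Suc i)
  then show ?case using sum_cg_weight_Suc[of i a k b] by simp
qed

subsection \<open>Inner products in coordinates\<close>

text \<open>Monomial coordinates. Coefficients of index above \<tau> are ignored, so a polynomial
  fixes \<open>c\<close> only up to \<tau>.\<close>

definition hpoly :: "nat \<Rightarrow> (nat \<Rightarrow> complex) \<Rightarrow> complex \<Rightarrow> complex" where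
  "hpoly \<tau> c = (\<lambda>z. \<Sum>i\<le>\<tau>. c i * z ^ i)"

definition tpoly :: "nat \<Rightarrow> nat \<Rightarrow> (nat \<Rightarrow> nat \<Rightarrow> complex) \<Rightarrow> complex \<Rightarrow> complex \<Rightarrow> complex" where
  "tpoly \<mu> \<nu> c = (\<lambda>z w. \<Sum>i\<le>\<mu>. \<Sum>j\<le>\<nu>. c i j * z ^ i * w ^ j)"

lemma Hsp_eq: "Hsp \<tau> = range (hpoly \<tau>)"
  unfolding Hsp_def hpoly_def by auto

lemma Tsp_eq: "Tsp \<mu> \<nu> = range (tpoly \<mu> \<nu>)"
  unfolding Tsp_def tpoly_def by auto

lemma sum_delta_mult:
  fixes c :: "'b::semiring_0"
  assumes "finite A"
  shows "(\<Sum>x\<in>A. (if x = y then c else 0) * f x) = (if y \<in> A then c * f y else 0)"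
proof -
  have "(\<Sum>x\<in>A. (if x = y then c else 0) * f x) = (\<Sum>x\<in>A. if x = y then c * f y else 0)"
    by (rule sum.cong) auto
  also have "\<dots> = (if y \<in> A then c * f y else 0)" using assms by (simp add: sum.delta)
  finally show ?thesis .
qed

lemma has_bochner_integral_pair_product:
  fixes f :: "'a::euclidean_space \<Rightarrow> complex" and g :: "'b::euclidean_space \<Rightarrow> complex"
  assumes f: "has_bochner_integral lborel f x" and g: "has_bochner_integral lborel g y"
  shows "has_bochner_integral (lborel \<Otimes>\<^sub>M lborel) (\<lambda>p. f (fst p) * g (snd p)) (x * y)"
proof -
  have fi: "integrable lborel f" "integral\<^sup>L lborel f = x" and gi: "integrable lborel g" "integral\<^sup>L lborel g = y"
    using f g by (auto simp: has_bochner_integral_iff)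
  have [measurable]: "f \<in> borel_measurable borel" "g \<in> borel_measurable borel"
    using fi gi by auto
  have int: "integrable (lborel \<Otimes>\<^sub>M lborel) (\<lambda>p. f (fst p) * g (snd p))"
  proof (rule lborel_pair.Fubini_integrable)
    show "(\<lambda>p. f (fst p) * g (snd p)) \<in> borel_measurable (lborel \<Otimes>\<^sub>M lborel)" by measurable
    show "integrable lborel (\<lambda>x. \<integral>y. norm (f (fst (x, y)) * g (snd (x, y))) \<partial>lborel)"
      using fi by (simp add: norm_mult)
    show "AE x in lborel. integrable lborel (\<lambda>y. f (fst (x, y)) * g (snd (x, y)))"
      using gi by simp
  qed
  have "(\<integral>p. f (fst p) * g (snd p) \<partial>(lborel \<Otimes>\<^sub>M lborel)) = x * y"
    using lborel_pair.integral_fst'[OF int] fi gi by simp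
  with int show ?thesis by (simp add: has_bochner_integral_iff)
qed

text \<open>Parseval's identity for an orthogonal family with weight \<open>w\<close> and squared
  norms \<open>N\<close>; the abstract index set covers both single exponents and pairs of
  exponents.\<close>

lemma integral_orthogonal_sums:
  fixes m :: "'i \<Rightarrow> 'a \<Rightarrow> complex"
  assumes A: "finite A"
    and m: "\<And>x y. x \<in> A \<Longrightarrow> y \<in> A \<Longrightarrow>
      has_bochner_integral M (\<lambda>p. m x p * cnj (m y p) * w p) (if x = y then N x else 0)"
  shows "(\<integral>p. (\<Sum>x\<in>A. c x * m x p) * cnj (\<Sum>y\<in>A. d y * m y p) * w p \<partial>M) = (\<Sum>x\<in>A. c x * cnj (d x) * N x)"
proof -
  have "has_bochner_integral M (\<lambda>p. \<Sum>x\<in>A. \<Sum>y\<in>A. c x * cnj (d y) * (m x p * cnj (m y p) * w p))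
      (\<Sum>x\<in>A. \<Sum>y\<in>A. c x * cnj (d y) * (if x = y then N x else 0))"
    by (intro has_bochner_integral_sum has_bochner_integral_mult_right m)
  also have "(\<lambda>p. \<Sum>x\<in>A. \<Sum>y\<in>A. c x * cnj (d y) * (m x p * cnj (m y p) * w p))
      = (\<lambda>p. (\<Sum>x\<in>A. c x * m x p) * cnj (\<Sum>y\<in>A. d y * m y p) * w p)"
    unfolding cnj_sum sum_product sum_distrib_right complex_cnj_mult by (simp only: sum_distrib_left mult_ac)
  finally show ?thesis
    using A by (simp add: has_bochner_integral_iff if_distrib cong: if_cong)
qed

lemma has_bochner_integral_monomials_dens:
  assumes "i \<le> \<tau>" "j \<le> \<tau>"
  shows "has_bochner_integral lborel (\<lambda>z. z ^ i * cnj z ^ j * dens \<tau> z)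
    (if i = j then 1 / of_nat (\<tau> choose i) else 0)"
  unfolding has_bochner_integral_iff
  using integrable_monomials_dens[OF assms] integral_monomials_dens[OF assms] ..

lemma ipH_hpoly:
  "ipH \<tau> (hpoly \<tau> c) (hpoly \<tau> d) = (\<Sum>i\<le>\<tau>. c i * cnj (d i) / of_nat (\<tau> choose i))"
proof -
  have "(\<integral>z. (\<Sum>x\<in>{..\<tau>}. c x * z ^ x) * cnj (\<Sum>y\<in>{..\<tau>}. d y * z ^ y) * dens \<tau> z \<partial>lborel)
      = (\<Sum>x\<in>{..\<tau>}. c x * cnj (d x) * (1 / of_nat (\<tau> choose x)))"
    by (rule integral_orthogonal_sums)
      (simp_all only: finite_atMost atMost_iff complex_cnj_power has_bochner_integral_monomials_dens)
  then show ?thesis by (simp only: ipH_def hpoly_def times_divide_eq_right mult_1_right)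
qed

lemma ipT_tpoly:
  "ipT \<mu> \<nu> (tpoly \<mu> \<nu> c) (tpoly \<mu> \<nu> d)
    = (\<Sum>i\<le>\<mu>. \<Sum>j\<le>\<nu>. c i j * cnj (d i j) / (of_nat (\<mu> choose i) * of_nat (\<nu> choose j)))"
proof -
  let ?A = "{..\<mu>} \<times> {..\<nu>}"
  define m :: "nat \<times> nat \<Rightarrow> complex \<times> complex \<Rightarrow> complex" where "m x p = fst p ^ fst x * snd p ^ snd x" for x p
  have "(\<integral>p. (\<Sum>x\<in>?A. case_prod c x * m x p) * cnj (\<Sum>y\<in>?A. case_prod d y * m y p)
      * (dens \<mu> (fst p) * dens \<nu> (snd p)) \<partial>(lborel \<Otimes>\<^sub>M lborel))
    = (\<Sum>x\<in>?A. case_prod c x * cnj (case_prod d x) * (1 / (of_nat (\<mu> choose fst x) * of_nat (\<nu> choose snd x))))"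
  proof (rule integral_orthogonal_sums)
    fix x y assume "x \<in> ?A" "y \<in> ?A"
    then have *: "fst x \<le> \<mu>" "snd x \<le> \<nu>" "fst y \<le> \<mu>" "snd y \<le> \<nu>" by auto
    note has_bochner_integral_pair_product[OF
        has_bochner_integral_monomials_dens[OF *(1,3)] has_bochner_integral_monomials_dens[OF *(2,4)]]
    moreover have "(if fst x = fst y then 1 / complex_of_nat (\<mu> choose fst x) else 0)
          * (if snd x = snd y then 1 / of_nat (\<nu> choose snd x) else 0)
        = (if x = y then 1 / (of_nat (\<mu> choose fst x) * of_nat (\<nu> choose snd x)) else 0)"
      by (simp add: prod_eq_iff)
    moreover have "(fst p ^ fst x * cnj (fst p) ^ fst y * dens \<mu> (fst p)) * (snd p ^ snd x * cnj (snd p) ^ snd y * dens \<nu> (snd p))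
        = m x p * cnj (m y p) * (dens \<mu> (fst p) * dens \<nu> (snd p))" for p
      by (simp add: m_def mult_ac)
    ultimately show "has_bochner_integral (lborel \<Otimes>\<^sub>M lborel) (\<lambda>p. m x p * cnj (m y p) * (dens \<mu> (fst p) * dens \<nu> (snd p)))
        (if x = y then 1 / (of_nat (\<mu> choose fst x) * of_nat (\<nu> choose snd x)) else 0)"
      by (simp only:)
  qed simp
  moreover have "tpoly \<mu> \<nu> e (fst p) (snd p) = (\<Sum>x\<in>?A. case_prod e x * m x p)" for e p
    by (simp add: tpoly_def m_def sum.cartesian_product case_prod_unfold mult.assoc)
  ultimately have "ipT \<mu> \<nu> (tpoly \<mu> \<nu> c) (tpoly \<mu> \<nu> d)
    = (\<Sum>x\<in>?A. case_prod c x * cnj (case_prod d x) * (1 / (of_nat (\<mu> choose fst x) * of_nat (\<nu> choose snd x))))"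
    unfolding ipT_def by (simp only: mult.assoc)
  also have "\<dots> = (\<Sum>(i, j)\<in>?A. c i j * cnj (d i j) / (of_nat (\<mu> choose i) * of_nat (\<nu> choose j)))"
    by (simp add: case_prod_unfold)
  finally show ?thesis by (simp only: sum.cartesian_product)
qed

section \<open>Polynomial expansion of the kernel\<close>

text \<open>Multiplication by a variable shifts coefficients by one; this re-indexes the sum when
  nothing is lost at either end.\<close>

lemma sum_atMost_shift_eq:
  fixes G H :: "nat \<Rightarrow> 'a::comm_monoid_add"
  assumes "G 0 = 0" "H n = 0" "\<And>i. G (Suc i) = H i"
  shows "(\<Sum>i\<le>n. G i) = (\<Sum>i\<le>n. H i)"
proof (cases n)
  case (Suc m)
  have "(\<Sum>i\<le>Suc m. G i) = (\<Sum>i\<le>m. H i)"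
    unfolding sum.atMost_Suc_shift using assms by simp
  then show ?thesis using Suc assms(2) by simp
qed (use assms in simp)

text \<open>The variable \<open>s\<close> records the total degree above \<open>k\<close>. A common
  large range \<open>n\<close> for both indices lets the induction proceed without adjusting
  summation bounds.\<close>

lemma cg_expansion_aux:
  fixes z w s :: complex
  assumes "a + b + k \<le> n"
  shows "(z - w) ^ k * (1 + s * z) ^ a * (1 + s * w) ^ b
    = (\<Sum>i\<le>n. \<Sum>j\<le>n. of_real (cg k a b (int i) (int j)) * s ^ (i + j - k) * z ^ i * w ^ j)"
  using assms
proof (induction k a b rule: cg.induct)
  case (1 k a b)
  let ?t = "\<lambda>i j. of_real (cg k a b (int i) (int j)) * s ^ (i + j - k) * z ^ i * w ^ j"
  \<comment> \<open>By the bound on \<open>n\<close>, the indices -1 and \<open>n\<close> both lie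
    outside the support of the smaller kernel, so the shifts lose no terms.\<close>
  have 0: "cg k a b (-1) j = 0" "cg k a b j (-1) = 0" "cg k a b (int n) j = 0" "cg k a b j (int n) = 0" for j
    using cg_support[of k a b "-1" j] cg_support[of k a b j "-1"] cg_support[of k a b "int n" j]
      cg_support[of k a b j "int n"] "1.prems" by linarith+
  have "(\<Sum>i\<le>n. \<Sum>j\<le>n. of_real (cg k a b (int i - 1) (int j)) * s ^ (i + j - Suc k) * z ^ i * w ^ j)
      = (\<Sum>i\<le>n. \<Sum>j\<le>n. z * ?t i j)"
    by (rule sum_atMost_shift_eq) (simp_all add: 0 mult_ac)
  moreover have "(\<Sum>i\<le>n. \<Sum>j\<le>n. of_real (cg k a b (int i) (int j - 1)) * s ^ (i + j - Suc k) * z ^ i * w ^ j)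
      = (\<Sum>i\<le>n. \<Sum>j\<le>n. w * ?t i j)"
    by (intro sum.cong refl sum_atMost_shift_eq) (simp_all add: 0 mult_ac)
  ultimately have "(\<Sum>i\<le>n. \<Sum>j\<le>n. of_real (cg (Suc k) a b (int i) (int j)) * s ^ (i + j - Suc k) * z ^ i * w ^ j)
      = (z - w) * (\<Sum>i\<le>n. \<Sum>j\<le>n. ?t i j)"
    by (simp add: left_diff_distrib sum_subtractf sum_distrib_left)
  then show ?case using "1.IH" "1.prems" by (simp add: mult_ac)
next
  case (2 a b)
  let ?t = "\<lambda>i j. of_real (cg 0 a b (int i) (int j)) * s ^ (i + j) * z ^ i * w ^ j"
  have 0: "cg 0 a b (-1) j = 0" "cg 0 a b (int n) j = 0" for j
    using cg_support[of 0 a b "-1" j] cg_support[of 0 a b "int n" j] "2.prems" by linarith+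
  have "(\<Sum>i\<le>n. \<Sum>j\<le>n. of_real (cg 0 a b (int i - 1) (int j)) * s ^ (i + j) * z ^ i * w ^ j)
      = (\<Sum>i\<le>n. \<Sum>j\<le>n. s * z * ?t i j)"
    by (rule sum_atMost_shift_eq) (simp_all add: 0 mult_ac)
  then have "(\<Sum>i\<le>n. \<Sum>j\<le>n. of_real (cg 0 (Suc a) b (int i) (int j)) * s ^ (i + j) * z ^ i * w ^ j)
      = (1 + s * z) * (\<Sum>i\<le>n. \<Sum>j\<le>n. ?t i j)"
    by (simp add: distrib_right sum.distrib sum_distrib_left)
  then show ?case using "2.IH" "2.prems" by (simp add: mult_ac)
next
  case (3 b)
  let ?t = "\<lambda>i j. of_real (cg 0 0 b (int i) (int j)) * s ^ (i + j) * z ^ i * w ^ j"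
  have 0: "cg 0 0 b j (-1) = 0" "cg 0 0 b j (int n) = 0" for j
    using cg_support[of 0 0 b j "-1"] cg_support[of 0 0 b j "int n"] "3.prems" by linarith+
  have "(\<Sum>i\<le>n. \<Sum>j\<le>n. of_real (cg 0 0 b (int i) (int j - 1)) * s ^ (i + j) * z ^ i * w ^ j)
      = (\<Sum>i\<le>n. \<Sum>j\<le>n. s * w * ?t i j)"
    by (intro sum.cong refl sum_atMost_shift_eq) (simp_all add: 0 mult_ac)
  then have "(\<Sum>i\<le>n. \<Sum>j\<le>n. of_real (cg 0 0 (Suc b) (int i) (int j)) * s ^ (i + j) * z ^ i * w ^ j)
      = (1 + s * w) * (\<Sum>i\<le>n. \<Sum>j\<le>n. ?t i j)"
    by (simp add: distrib_right sum.distrib sum_distrib_left)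
  then show ?case using "3.IH" "3.prems" by (simp add: mult_ac)
next
  case 4
  have "(\<Sum>i\<le>n. \<Sum>j\<le>n. of_real (cg 0 0 0 (int i) (int j)) * s ^ (i + j) * z ^ i * w ^ j)
     = (\<Sum>i\<le>n. (if i = 0 then 1 else 0) * (\<Sum>j\<le>n. (if j = 0 then 1 else 0) * 1))"
    unfolding sum_distrib_left by (intro sum.cong refl) auto
  also have "\<dots> = 1" unfolding sum_delta_mult[OF finite_atMost] by simp
  finally show ?case by simp
qed

lemma cg_expansion:
  fixes z w s :: complex
  shows "(z - w) ^ k * (1 + s * z) ^ a * (1 + s * w) ^ b
    = tpoly (a + k) (b + k) (\<lambda>i j. of_real (cg k a b (int i) (int j)) * s ^ (i + j - k)) z w"
proof -
  let ?t = "\<lambda>i j. of_real (cg k a b (int i) (int j)) * s ^ (i + j - k) * z ^ i * w ^ j"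
  have 0: "cg k a b (int i) (int j) = 0" if "\<not> (i \<le> a + k \<and> j \<le> b + k)" for i j
    using cg_support[of k a b "int i" "int j"] that by linarith
  have "(\<Sum>i\<le>a + b + k. \<Sum>j\<le>a + b + k. ?t i j) = (\<Sum>i\<le>a + b + k. \<Sum>j\<le>b + k. ?t i j)"
    by (intro sum.cong refl sum.mono_neutral_right) (auto simp: 0)
  also have "\<dots> = (\<Sum>i\<le>a + k. \<Sum>j\<le>b + k. ?t i j)"
    by (intro sum.mono_neutral_right) (auto simp: 0)
  finally show ?thesis
    using cg_expansion_aux[of a b k "a + b + k" z w s] by (simp add: tpoly_def)
qed

subsection \<open>The channel in coordinates\<close>

lemma hpoly_add_scaled:
  "(\<lambda>z. x * hpoly \<tau> c z + y * hpoly \<tau> d z) = hpoly \<tau> (\<lambda>i. x * c i + y * d i)"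
  by (simp add: hpoly_def sum_distrib_left distrib_right sum.distrib mult.assoc)

text \<open>Pairing with z^i isolates the i-th coefficient by orthogonality.\<close>

lemma hpoly_inj:
  assumes "hpoly \<tau> c = hpoly \<tau> d" "i \<le> \<tau>"
  shows "c i = d i"
proof -
  have "ipH \<tau> (hpoly \<tau> c) (hpoly \<tau> (\<lambda>j. if j = i then 1 else 0))
      = ipH \<tau> (hpoly \<tau> d) (hpoly \<tau> (\<lambda>j. if j = i then 1 else 0))"
    using assms by simp
  then have "c i / of_nat (\<tau> choose i) = d i / of_nat (\<tau> choose i)"
    using assms(2) unfolding ipH_hpoly by (simp add: if_distrib if_distribR sum.delta cong: if_cong)
  then show ?thesis using assms(2) by simp
qed

text \<open>Nondegeneracy of the inner product, which yields uniqueness for the definite description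
  in \<open>Pk_adj\<close>.\<close>

lemma tpoly_ext_ipT:
  assumes "\<And>c. ipT \<mu> \<nu> (tpoly \<mu> \<nu> c) (tpoly \<mu> \<nu> d) = ipT \<mu> \<nu> (tpoly \<mu> \<nu> c) (tpoly \<mu> \<nu> e)"
  shows "tpoly \<mu> \<nu> d = tpoly \<mu> \<nu> e"
proof -
  have "d i j = e i j" if "i \<le> \<mu>" "j \<le> \<nu>" for i j
  proof -
    define \<delta> where "\<delta> i' j' = (if i' = i then 1 else 0) * (if j' = j then 1 else (0::complex))" for i' j'
    have "ipT \<mu> \<nu> (tpoly \<mu> \<nu> \<delta>) (tpoly \<mu> \<nu> d) = cnj (d i j) / (of_nat (\<mu> choose i) * of_nat (\<nu> choose j))" for d
      unfolding ipT_tpoly \<delta>_def mult.assoc times_divide_eq_right[symmetric] sum_distrib_left[symmetric]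
        sum_delta_mult[OF finite_atMost] using that by simp
    then show ?thesis using assms[of \<delta>] that by simp
  qed
  then show ?thesis unfolding tpoly_def by (intro ext sum.cong refl) simp
qed

lemma pcoeff_hpoly:
  assumes "i \<le> \<tau>"
  shows "pcoeff \<tau> (hpoly \<tau> c) i = c i"
proof -
  \<comment> \<open>\<open>pcoeff\<close> selects the coefficient function that vanishes above
    \<tau>, hence the truncation.\<close>
  define c' where "c' i = (if i \<le> \<tau> then c i else 0)" for i
  have "pcoeff \<tau> (hpoly \<tau> c) = c'"
    unfolding pcoeff_def
  proof (rule the_equality)
    show "hpoly \<tau> c = (\<lambda>z. \<Sum>i\<le>\<tau>. c' i * z ^ i) \<and> (\<forall>i>\<tau>. c' i = 0)"
      by (simp add: hpoly_def c'_def)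
    fix d assume d: "hpoly \<tau> c = (\<lambda>z. \<Sum>i\<le>\<tau>. d i * z ^ i) \<and> (\<forall>i>\<tau>. d i = 0)"
    then have "hpoly \<tau> c = hpoly \<tau> d" by (simp add: hpoly_def)
    with d show "d = c'"
      by (intro ext) (metis c'_def hpoly_inj not_le)
  qed
  then show ?thesis using assms by (simp add: c'_def)
qed

lemma power_eq_hpoly:
  assumes "i \<le> \<tau>"
  shows "(\<lambda>z. z ^ i) = hpoly \<tau> (\<lambda>j. if j = i then 1 else 0)"
  unfolding hpoly_def sum_delta_mult[OF finite_atMost] using assms by simp

lemma Bop_hpoly:
  assumes A: "A \<in> Bop \<tau>"
  obtains \<alpha> where "\<And>i. i \<le> \<tau> \<Longrightarrow> A (\<lambda>z. z ^ i) = hpoly \<tau> (\<lambda>b. \<alpha> b i)"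
    and "\<And>d. A (hpoly \<tau> d) = hpoly \<tau> (\<lambda>b. \<Sum>i\<le>\<tau>. \<alpha> b i * d i)"
proof -
  have lin: "A (\<lambda>z. x * f z + y * g z) = (\<lambda>z. x * A f z + y * A g z)" if "f \<in> Hsp \<tau>" "g \<in> Hsp \<tau>" for f g x y
    using A that by (simp add: Bop_def lin_on_def)
  have "\<exists>c. A (\<lambda>z. z ^ i) = hpoly \<tau> c" if "i \<le> \<tau>" for i
    using A that power_eq_hpoly[OF that] unfolding Bop_def Hsp_eq by auto
  then obtain c where c: "\<And>i. i \<le> \<tau> \<Longrightarrow> A (\<lambda>z. z ^ i) = hpoly \<tau> (c i)" by metis
  \<comment> \<open>\<open>lin_on\<close> speaks of two-term combinations only, so the matrix
    formula is built up one monomial at a time.\<close>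
  have part: "A (hpoly \<tau> (\<lambda>i. if i < n then d i else 0)) = hpoly \<tau> (\<lambda>b. \<Sum>i<n. c i b * d i)"
    if "n \<le> Suc \<tau>" for n d
    using that
  proof (induction n)
    case 0
    have "A (hpoly \<tau> (\<lambda>_. 0)) = (\<lambda>z. 0)"
      using lin[of "hpoly \<tau> (\<lambda>_. 0)" "hpoly \<tau> (\<lambda>_. 0)" 0 0]
      by (simp add: Hsp_eq) (simp add: hpoly_def)
    then show ?case by (simp add: hpoly_def)
  next
    case (Suc n)
    then have n: "n \<le> \<tau>" by simp
    have "A (hpoly \<tau> (\<lambda>i. if i < Suc n then d i else 0))
        = A (\<lambda>z. 1 * hpoly \<tau> (\<lambda>i. if i < n then d i else 0) z + d n * z ^ n)"
      unfolding power_eq_hpoly[OF n, THEN fun_cong] hpoly_add_scaled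
      by (intro arg_cong[of _ _ A] arg_cong[of _ _ "hpoly \<tau>"] ext) (auto simp: less_Suc_eq)
    also have "\<dots> = (\<lambda>z. 1 * A (hpoly \<tau> (\<lambda>i. if i < n then d i else 0)) z + d n * A (\<lambda>z. z ^ n) z)"
      by (rule lin) (auto simp: Hsp_eq power_eq_hpoly[OF n])
    also have "\<dots> = hpoly \<tau> (\<lambda>b. \<Sum>i<Suc n. c i b * d i)"
      using Suc n by (simp only: c hpoly_add_scaled) (simp add: mult.commute)
    finally show ?case .
  qed
  have "A (hpoly \<tau> d) = hpoly \<tau> (\<lambda>b. \<Sum>i\<le>\<tau>. c i b * d i)" for d
  proof -
    have "hpoly \<tau> d = hpoly \<tau> (\<lambda>i. if i < Suc \<tau> then d i else 0)"
      by (simp add: hpoly_def)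
    then show ?thesis using part[of "Suc \<tau>" d] by (simp add: lessThan_Suc_atMost)
  qed
  with c show thesis by (intro that[of "\<lambda>b i. c i b"]) auto
qed

lemma tensorI_tpoly:
  assumes "\<And>d. A (hpoly \<mu> d) = hpoly \<mu> (\<lambda>b. \<Sum>i\<le>\<mu>. \<alpha> b i * d i)"
  shows "tensorI A (tpoly \<mu> \<nu> g) = tpoly \<mu> \<nu> (\<lambda>b j. \<Sum>i\<le>\<mu>. \<alpha> b i * g i j)"
proof (intro ext)
  fix z w
  have "(\<lambda>z'. tpoly \<mu> \<nu> g z' w) = hpoly \<mu> (\<lambda>i. \<Sum>j\<le>\<nu>. g i j * w ^ j)"
    by (simp add: tpoly_def hpoly_def sum_distrib_left sum_distrib_right mult_ac)
  then have "tensorI A (tpoly \<mu> \<nu> g) z w = (\<Sum>b\<le>\<mu>. (\<Sum>i\<le>\<mu>. \<alpha> b i * (\<Sum>j\<le>\<nu>. g i j * w ^ j)) * z ^ b)"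
    by (simp add: tensorI_def assms) (simp add: hpoly_def)
  also have "\<dots> = (\<Sum>b\<le>\<mu>. \<Sum>i\<le>\<mu>. \<Sum>j\<le>\<nu>. \<alpha> b i * g i j * z ^ b * w ^ j)"
    by (simp add: sum_distrib_left sum_distrib_right mult_ac)
  also have "\<dots> = (\<Sum>b\<le>\<mu>. \<Sum>j\<le>\<nu>. \<Sum>i\<le>\<mu>. \<alpha> b i * g i j * z ^ b * w ^ j)"
    by (intro sum.cong refl sum.swap)
  also have "\<dots> = tpoly \<mu> \<nu> (\<lambda>b j. \<Sum>i\<le>\<mu>. \<alpha> b i * g i j) z w"
    by (simp add: tpoly_def sum_distrib_right)
  finally show "tensorI A (tpoly \<mu> \<nu> g) z w = tpoly \<mu> \<nu> (\<lambda>b j. \<Sum>i\<le>\<mu>. \<alpha> b i * g i j) z w" .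
qed

lemma tensorI_Tsp:
  assumes "A \<in> Bop \<mu>" "F \<in> Tsp \<mu> \<nu>"
  shows "tensorI A F \<in> Tsp \<mu> \<nu>"
proof -
  obtain \<alpha> where \<alpha>0: "\<And>i. i \<le> \<mu> \<Longrightarrow> A (\<lambda>z. z ^ i) = hpoly \<mu> (\<lambda>b. \<alpha> b i)"
    and \<alpha>: "\<And>d. A (hpoly \<mu> d) = hpoly \<mu> (\<lambda>b. \<Sum>i\<le>\<mu>. \<alpha> b i * d i)"
    by (rule Bop_hpoly[OF assms(1)]) blast
  obtain g where g: "F = tpoly \<mu> \<nu> g" using assms(2) by (auto simp: Tsp_eq)
  show ?thesis unfolding g tensorI_tpoly[OF \<alpha>] Tsp_eq by (rule rangeI)
qed

text \<open>Distinct powers of w are orthogonal, so the form of A \<otimes> I splits into forms of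
  \<open>A\<close> on the coefficients of w^l, with positive weights. Complete positivity rests on
  this.\<close>

lemma ipT_tensorI:
  assumes "A \<in> Bop \<mu>"
  shows "ipT \<mu> \<nu> (tensorI A (tpoly \<mu> \<nu> g)) (tpoly \<mu> \<nu> h)
    = (\<Sum>l\<le>\<nu>. ipH \<mu> (A (hpoly \<mu> (\<lambda>i. g i l))) (hpoly \<mu> (\<lambda>i. h i l)) / of_nat (\<nu> choose l))"
proof -
  obtain \<alpha> where \<alpha>0: "\<And>i. i \<le> \<mu> \<Longrightarrow> A (\<lambda>z. z ^ i) = hpoly \<mu> (\<lambda>b. \<alpha> b i)"
    and \<alpha>: "\<And>d. A (hpoly \<mu> d) = hpoly \<mu> (\<lambda>b. \<Sum>i\<le>\<mu>. \<alpha> b i * d i)"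
    by (rule Bop_hpoly[OF assms(1)]) blast
  define c where "c r j = (\<Sum>i\<le>\<mu>. \<alpha> r i * g i j)" for r j
  have "ipT \<mu> \<nu> (tensorI A (tpoly \<mu> \<nu> g)) (tpoly \<mu> \<nu> h)
      = (\<Sum>r\<le>\<mu>. \<Sum>l\<le>\<nu>. c r l * cnj (h r l) / (of_nat (\<mu> choose r) * of_nat (\<nu> choose l)))"
    unfolding tensorI_tpoly[OF \<alpha>] ipT_tpoly c_def ..
  also have "\<dots> = (\<Sum>l\<le>\<nu>. \<Sum>r\<le>\<mu>. c r l * cnj (h r l) / (of_nat (\<mu> choose r) * of_nat (\<nu> choose l)))"
    by (rule sum.swap)
  also have "\<dots> = (\<Sum>l\<le>\<nu>. (\<Sum>r\<le>\<mu>. c r l * cnj (h r l) / of_nat (\<mu> choose r)) / of_nat (\<nu> choose l))"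
    by (simp only: sum_divide_distrib divide_divide_eq_left)
  also have "\<dots> = (\<Sum>l\<le>\<nu>. ipH \<mu> (A (hpoly \<mu> (\<lambda>i. g i l))) (hpoly \<mu> (\<lambda>i. h i l)) / of_nat (\<nu> choose l))"
    by (simp only: \<alpha> ipH_hpoly c_def)
  finally show ?thesis .
qed

section \<open>P_k, its adjoint and the channel in the monomial basis\<close>

context
  fixes k a b :: nat
begin

abbreviation cgc :: "nat \<Rightarrow> nat \<Rightarrow> complex" where
  "cgc i j \<equiv> of_real (cg k a b (int i) (int j))"

lemma cgc_supportD:
  assumes "cgc i j \<noteq> 0"
  shows "k \<le> i + j" "i + j - k \<le> a + b"
  using assms cg_support[of k a b "int i" "int j"] by auto

lemma Pk_tpoly:
  "Pk (a + k) (b + k) k (tpoly (a + k) (b + k) c) = hpoly (a + b) (\<lambda>m. \<Sum>i\<le>a + k. \<Sum>j\<le>b + k.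
     if i + j = m + k then of_real (Ck (a + k) (b + k) k) * c i j * cgc i j / (of_nat (a + k choose i) * of_nat (b + k choose j)) else 0)"
proof (rule ext)
  fix \<xi> :: complex
  let ?C = "complex_of_real (Ck (a + k) (b + k) k)"
  let ?t = "\<lambda>i j. ?C * c i j * cgc i j / (of_nat (a + k choose i) * of_nat (b + k choose j))"
  \<comment> \<open>The integral kernel is the conjugate of a polynomial in z and w, so J_k is an
    inner product against it and the expansion applies with \<open>s = cnj \<xi>\<close>.\<close>
  have "Jk (a + k) (b + k) k (tpoly (a + k) (b + k) c) \<xi>
    = ipT (a + k) (b + k) (tpoly (a + k) (b + k) c) (\<lambda>z w. (z - w) ^ k * (1 + cnj \<xi> * z) ^ a * (1 + cnj \<xi> * w) ^ b)"
    by (simp add: Jk_def ipT_def mult_ac)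
  also have "\<dots> = (\<Sum>i\<le>a + k. \<Sum>j\<le>b + k. c i j * (cgc i j * \<xi> ^ (i + j - k)) / (of_nat (a + k choose i) * of_nat (b + k choose j)))"
    unfolding cg_expansion ipT_tpoly by simp
  finally have "Pk (a + k) (b + k) k (tpoly (a + k) (b + k) c) \<xi> = (\<Sum>i\<le>a + k. \<Sum>j\<le>b + k. ?t i j * \<xi> ^ (i + j - k))"
    by (simp add: Pk_def sum_distrib_left mult_ac)
  \<comment> \<open>Collects powers of \<xi> through a delta sum over \<open>m\<close>; where i + j
    - k would truncate or exceed a + b, the kernel coefficient is zero.\<close>
  also have "\<dots> = (\<Sum>i\<le>a + k. \<Sum>j\<le>b + k. \<Sum>m\<le>a + b. (if i + j = m + k then ?t i j else 0) * \<xi> ^ m)"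
  proof (intro sum.cong refl)
    fix i j
    show "?t i j * \<xi> ^ (i + j - k) = (\<Sum>m\<le>a + b. (if i + j = m + k then ?t i j else 0) * \<xi> ^ m)"
    proof (cases "cgc i j = 0")
      case False
      from cgc_supportD[OF this] have "i + j = m + k \<longleftrightarrow> m = i + j - k" for m by auto
      then show ?thesis
        using cgc_supportD[OF False] by (simp only: sum_delta_mult[OF finite_atMost] atMost_iff if_True)
    qed (auto intro!: sum.neutral)
  qed
  also have "\<dots> = (\<Sum>i\<le>a + k. \<Sum>m\<le>a + b. \<Sum>j\<le>b + k. (if i + j = m + k then ?t i j else 0) * \<xi> ^ m)"
    by (intro sum.cong refl sum.swap)
  also have "\<dots> = (\<Sum>m\<le>a + b. \<Sum>i\<le>a + k. \<Sum>j\<le>b + k. (if i + j = m + k then ?t i j else 0) * \<xi> ^ m)"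
    by (rule sum.swap)
  finally show "Pk (a + k) (b + k) k (tpoly (a + k) (b + k) c) \<xi> = hpoly (a + b) (\<lambda>m. \<Sum>i\<le>a + k. \<Sum>j\<le>b + k.
     if i + j = m + k then ?t i j else 0) \<xi>"
    by (simp add: hpoly_def sum_distrib_right)
qed

text \<open>Exchanging summations exhibits the adjoint matrix. As \<open>Ck\<close> and
  \<open>cgc\<close> are real, it is the transpose weighted by the norms of the monomials.\<close>

lemma ipH_Pk_tpoly:
  "ipH (a + b) (Pk (a + k) (b + k) k (tpoly (a + k) (b + k) c)) (hpoly (a + b) d)
    = ipT (a + k) (b + k) (tpoly (a + k) (b + k) c) (tpoly (a + k) (b + k)
        (\<lambda>i j. of_real (Ck (a + k) (b + k) k) * cgc i j * d (i + j - k) / of_nat (a + b choose (i + j - k))))"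
proof -
  let ?C = "complex_of_real (Ck (a + k) (b + k) k)"
  let ?t = "\<lambda>i j. ?C * c i j * cgc i j / (of_nat (a + k choose i) * of_nat (b + k choose j))"
  have "ipH (a + b) (Pk (a + k) (b + k) k (tpoly (a + k) (b + k) c)) (hpoly (a + b) d)
    = (\<Sum>m\<le>a + b. \<Sum>i\<le>a + k. \<Sum>j\<le>b + k. (if i + j = m + k then ?t i j else 0) * (cnj (d m) / of_nat (a + b choose m)))"
    unfolding Pk_tpoly ipH_hpoly by (simp add: sum_distrib_right sum_divide_distrib)
  also have "\<dots> = (\<Sum>i\<le>a + k. \<Sum>m\<le>a + b. \<Sum>j\<le>b + k. (if i + j = m + k then ?t i j else 0) * (cnj (d m) / of_nat (a + b choose m)))"
    by (rule sum.swap)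
  also have "\<dots> = (\<Sum>i\<le>a + k. \<Sum>j\<le>b + k. \<Sum>m\<le>a + b. (if i + j = m + k then ?t i j else 0) * (cnj (d m) / of_nat (a + b choose m)))"
    by (intro sum.cong refl sum.swap)
  also have "\<dots> = (\<Sum>i\<le>a + k. \<Sum>j\<le>b + k. ?t i j * (cnj (d (i + j - k)) / of_nat (a + b choose (i + j - k))))"
  proof (intro sum.cong refl)
    fix i j
    show "(\<Sum>m\<le>a + b. (if i + j = m + k then ?t i j else 0) * (cnj (d m) / of_nat (a + b choose m)))
      = ?t i j * (cnj (d (i + j - k)) / of_nat (a + b choose (i + j - k)))"
    proof (cases "cgc i j = 0")
      case False
      from cgc_supportD[OF this] have "i + j = m + k \<longleftrightarrow> m = i + j - k" for m by auto
      then show ?thesis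
        using cgc_supportD[OF False] by (simp only: sum_delta_mult[OF finite_atMost] atMost_iff if_True)
    qed (auto intro!: sum.neutral)
  qed
  finally show ?thesis unfolding ipT_tpoly by (simp add: mult_ac)
qed

lemma Pk_adj_hpoly:
  "Pk_adj (a + k) (b + k) k (hpoly (a + b) d) = tpoly (a + k) (b + k)
     (\<lambda>i j. of_real (Ck (a + k) (b + k) k) * cgc i j * d (i + j - k) / of_nat (a + b choose (i + j - k)))"
proof -
  have e: "a + k + (b + k) - 2 * k = a + b" by simp
  show ?thesis unfolding Pk_adj_def e
  proof (rule the_equality, goal_cases)
    case 1
    then show ?case by (auto simp: Tsp_eq ipH_Pk_tpoly)
  next
    case (2 G)
    then obtain g where g: "G = tpoly (a + k) (b + k) g" by (auto simp: Tsp_eq)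
    show ?case unfolding g
      by (rule tpoly_ext_ipT) (use 2 in \<open>auto simp: Tsp_eq g ipH_Pk_tpoly\<close>)
  qed
qed

text \<open>Moves the outer P_k to the other argument, reducing the form of the channel to that of A
  \<otimes> I at adjoint vectors.\<close>

lemma ipH_Tmap:
  assumes "A \<in> Bop (a + k)" "f \<in> Hsp (a + b)" "g \<in> Hsp (a + b)"
  shows "ipH (a + b) (Tmap (a + k) (b + k) k A f) g
    = ipT (a + k) (b + k) (tensorI A (Pk_adj (a + k) (b + k) k f)) (Pk_adj (a + k) (b + k) k g)"
proof -
  obtain d e where d: "f = hpoly (a + b) d" and e: "g = hpoly (a + b) e"
    using assms by (auto simp: Hsp_eq)
  have "tensorI A (Pk_adj (a + k) (b + k) k f) \<in> Tsp (a + k) (b + k)"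
    by (rule tensorI_Tsp[OF assms(1)]) (auto simp: d Pk_adj_hpoly Tsp_eq)
  then obtain c where "tensorI A (Pk_adj (a + k) (b + k) k f) = tpoly (a + k) (b + k) c"
    by (auto simp: Tsp_eq)
  then show ?thesis unfolding Tmap_def e Pk_adj_hpoly[of e] by (simp add: ipH_Pk_tpoly)
qed

lemma Tmap_hpoly:
  assumes "\<And>d. A (hpoly (a + k) d) = hpoly (a + k) (\<lambda>b. \<Sum>i\<le>a + k. \<alpha> b i * d i)"
  shows "Tmap (a + k) (b + k) k A (hpoly (a + b) d) = hpoly (a + b) (\<lambda>n. \<Sum>r\<le>a + k. \<Sum>j\<le>b + k. \<Sum>i\<le>a + k.
     if r + j = n + k then (of_real (Ck (a + k) (b + k) k))\<^sup>2 * \<alpha> r i * cgc i j * cgc r j * d (i + j - k)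
       / (of_nat (a + b choose (i + j - k)) * of_nat (a + k choose r) * of_nat (b + k choose j)) else 0)"
  unfolding Tmap_def Pk_adj_hpoly tensorI_tpoly[OF assms] Pk_tpoly
proof (intro arg_cong[of _ _ "hpoly (a + b)"] ext sum.cong refl)
  fix n r j
  let ?C = "complex_of_real (Ck (a + k) (b + k) k)"
  have "?C * (\<Sum>i\<le>a + k. \<alpha> r i * (?C * cgc i j * d (i + j - k) / of_nat (a + b choose (i + j - k)))) * cgc r j
      / (of_nat (a + k choose r) * of_nat (b + k choose j))
    = (\<Sum>i\<le>a + k. ?C\<^sup>2 * \<alpha> r i * cgc i j * cgc r j * d (i + j - k)
       / (of_nat (a + b choose (i + j - k)) * of_nat (a + k choose r) * of_nat (b + k choose j)))"
    unfolding sum_distrib_left sum_distrib_right sum_divide_distrib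
    by (rule sum.cong) (simp_all add: power2_eq_square mult_ac)
  then show "(if r + j = n + k
      then ?C * (\<Sum>i\<le>a + k. \<alpha> r i * (?C * cgc i j * d (i + j - k) / of_nat (a + b choose (i + j - k)))) * cgc r j
        / (of_nat (a + k choose r) * of_nat (b + k choose j)) else 0)
    = (\<Sum>i\<le>a + k. if r + j = n + k then ?C\<^sup>2 * \<alpha> r i * cgc i j * cgc r j * d (i + j - k)
       / (of_nat (a + b choose (i + j - k)) * of_nat (a + k choose r) * of_nat (b + k choose j)) else 0)"
    by (cases "r + j = n + k") (simp_all only: if_True if_False sum.neutral_const simp_thms)
qed

lemma Tmap_Bop:
  assumes "A \<in> Bop (a + k)"
  shows "Tmap (a + k) (b + k) k A \<in> Bop (a + b)"
proof -
  obtain \<alpha> where \<alpha>0: "\<And>i. i \<le> a + k \<Longrightarrow> A (\<lambda>z. z ^ i) = hpoly (a + k) (\<lambda>b. \<alpha> b i)"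
    and \<alpha>: "\<And>d. A (hpoly (a + k) d) = hpoly (a + k) (\<lambda>b. \<Sum>i\<le>a + k. \<alpha> b i * d i)"
    by (rule Bop_hpoly[OF assms(1)]) blast
  have "Tmap (a + k) (b + k) k A (hpoly (a + b) (\<lambda>i. x * c i + y * d i))
      = (\<lambda>z. x * Tmap (a + k) (b + k) k A (hpoly (a + b) c) z + y * Tmap (a + k) (b + k) k A (hpoly (a + b) d) z)" for x y c d
    unfolding Tmap_hpoly[OF \<alpha>] hpoly_add_scaled sum_distrib_left sum.distrib[symmetric]
    by (intro arg_cong[of _ _ "hpoly (a + b)"] ext sum.cong refl)
      (simp add: add_divide_distrib distrib_left mult_ac)
  then show ?thesis
    unfolding Bop_def lin_on_def Hsp_eq by (auto simp: hpoly_add_scaled) (auto simp: Tmap_hpoly[OF \<alpha>])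
qed

section \<open>The trace\<close>

lemma trace_Tmap:
  assumes A: "A \<in> Bop (a + k)"
  shows "trH (a + b) (Tmap (a + k) (b + k) k A) = of_real ((real (a + b) + 1) / (real (a + k) + 1)) * trH (a + k) A"
proof -
  obtain \<alpha> where \<alpha>0: "\<And>i. i \<le> a + k \<Longrightarrow> A (\<lambda>z. z ^ i) = hpoly (a + k) (\<lambda>b. \<alpha> b i)"
    and \<alpha>: "\<And>d. A (hpoly (a + k) d) = hpoly (a + k) (\<lambda>b. \<Sum>i\<le>a + k. \<alpha> b i * d i)"
    by (rule Bop_hpoly[OF assms(1)]) blast
  let ?C = "complex_of_real (Ck (a + k) (b + k) k)"
  let ?t = "\<lambda>r j. ?C\<^sup>2 * \<alpha> r r * of_real (cg_weight k a b r j)"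
  have "trH (a + b) (Tmap (a + k) (b + k) k A) = (\<Sum>m\<le>a + b. \<Sum>r\<le>a + k. \<Sum>j\<le>b + k. if r + j = m + k then ?t r j else 0)"
    unfolding trH_def
  proof (intro sum.cong refl)
    fix m assume "m \<in> {..a + b}"
    then have m: "m \<le> a + b" by simp
    have "pcoeff (a + b) (Tmap (a + k) (b + k) k A (\<lambda>z. z ^ m)) m = (\<Sum>r\<le>a + k. \<Sum>j\<le>b + k. \<Sum>i\<le>a + k.
      if r + j = m + k then ?C\<^sup>2 * \<alpha> r i * cgc i j * cgc r j * (if i + j - k = m then 1 else 0)
       / (of_nat (a + b choose (i + j - k)) * of_nat (a + k choose r) * of_nat (b + k choose j)) else 0)"
      unfolding power_eq_hpoly[OF m] Tmap_hpoly[OF \<alpha>] by (rule pcoeff_hpoly[OF m])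
    also have "\<dots> = (\<Sum>r\<le>a + k. \<Sum>j\<le>b + k. if r + j = m + k then ?t r j else 0)"
    proof (intro sum.cong refl)
      fix r j assume r: "r \<in> {..a + k}"
      have "(\<Sum>i\<le>a + k.
      if r + j = m + k then ?C\<^sup>2 * \<alpha> r i * cgc i j * cgc r j * (if i + j - k = m then 1 else 0)
       / (of_nat (a + b choose (i + j - k)) * of_nat (a + k choose r) * of_nat (b + k choose j)) else 0)
        = (\<Sum>i\<le>a + k. if i = r then (if r + j = m + k then ?t r j else 0) else 0)"
      proof (intro sum.cong refl)
        fix i
        show "(if r + j = m + k then ?C\<^sup>2 * \<alpha> r i * cgc i j * cgc r j * (if i + j - k = m then 1 else 0)
           / (of_nat (a + b choose (i + j - k)) * of_nat (a + k choose r) * of_nat (b + k choose j)) else 0)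
          = (if i = r then (if r + j = m + k then ?t r j else 0) else 0)"
        proof (cases "cgc i j = 0")
          case False
          \<comment> \<open>On the diagonal, i + j - k = m and r + j = m + k force i = r, so only
            the diagonal entries of the matrix of \<open>A\<close> survive; the support bound
            excludes truncation.\<close>
          from cgc_supportD[OF this] have "i + j - k = m \<longleftrightarrow> i = r" if "r + j = m + k" using that by auto
          then show ?thesis by (auto simp: cg_weight_def power2_eq_square)
        next
          case True
          then show ?thesis by (auto simp: cg_weight_def)
        qed
      qed
      also have "\<dots> = (if r + j = m + k then ?t r j else 0)" using r by (simp add: sum.delta)
      finally show "(\<Sum>i\<le>a + k.
      if r + j = m + k then ?C\<^sup>2 * \<alpha> r i * cgc i j * cgc r j * (if i + j - k = m then 1 else 0)
       / (of_nat (a + b choose (i + j - k)) * of_nat (a + k choose r) * of_nat (b + k choose j)) else 0)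
        = (if r + j = m + k then ?t r j else 0)" .
    qed
    finally show "pcoeff (a + b) (Tmap (a + k) (b + k) k A (\<lambda>z. z ^ m)) m
      = (\<Sum>r\<le>a + k. \<Sum>j\<le>b + k. if r + j = m + k then ?t r j else 0)" .
  qed
  also have "\<dots> = (\<Sum>r\<le>a + k. \<Sum>m\<le>a + b. \<Sum>j\<le>b + k. if r + j = m + k then ?t r j else 0)"
    by (rule sum.swap)
  also have "\<dots> = (\<Sum>r\<le>a + k. \<Sum>j\<le>b + k. \<Sum>m\<le>a + b. if r + j = m + k then ?t r j else 0)"
    by (intro sum.cong refl sum.swap)
  also have "\<dots> = (\<Sum>r\<le>a + k. \<Sum>j\<le>b + k. ?t r j)"
  proof (intro sum.cong refl)
    fix r j
    show "(\<Sum>m\<le>a + b. if r + j = m + k then ?t r j else 0) = ?t r j"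
    proof (cases "cgc r j = 0")
      case False
      from cgc_supportD[OF this] have "r + j = m + k \<longleftrightarrow> m = r + j - k" for m by auto
      then show ?thesis using cgc_supportD[OF False] by (simp add: sum.delta)
    qed (auto simp: cg_weight_def intro!: sum.neutral)
  qed
  also have "\<dots> = (\<Sum>r\<le>a + k. \<alpha> r r * of_real ((Ck (a + k) (b + k) k)\<^sup>2 * (\<Sum>j\<le>b + k. cg_weight k a b r j)))"
    by (simp add: sum_distrib_left sum_distrib_right mult_ac)
  \<comment> \<open>The weight of each diagonal entry is independent of \<open>r\<close>, so the
    trace of \<open>A\<close> factors out.\<close>
  also have "\<dots> = (\<Sum>r\<le>a + k. \<alpha> r r * of_real ((real (a + b) + 1) / (real (a + k) + 1)))"
    by (intro sum.cong refl) (simp only: Ck_square_sum_cg_weight atMost_iff)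
  also have "\<dots> = of_real ((real (a + b) + 1) / (real (a + k) + 1)) * trH (a + k) A"
    unfolding trH_def by (simp only: sum_distrib_left) (intro sum.cong refl, simp add: \<alpha>0 pcoeff_hpoly)
  finally show ?thesis .
qed

section \<open>Complete positivity\<close>

lemma completely_positive_Tmap: "completely_positive (a + k) (a + b) (Tmap (a + k) (b + k) k)"
  unfolding completely_positive_def
proof (intro allI impI)
  fix n A
  assume A: "\<forall>i<n. \<forall>j<n. A i j \<in> Bop (a + k)" and pos: "block_pos (a + k) n A"
  show "block_pos (a + b) n (\<lambda>i j. Tmap (a + k) (b + k) k (A i j))"
    unfolding block_pos_def
  proof (intro allI impI)
    fix x :: "nat \<Rightarrow> complex \<Rightarrow> complex"
    assume x: "\<forall>i<n. x i \<in> Hsp (a + b)"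
    then have "\<forall>i<n. \<exists>d. x i = hpoly (a + b) d" by (auto simp: Hsp_eq)
    then obtain d where d: "\<And>i. i < n \<Longrightarrow> x i = hpoly (a + b) (d i)" by metis
    define g where "g r i j = of_real (Ck (a + k) (b + k) k) * cgc i j * d r (i + j - k) / of_nat (a + b choose (i + j - k))" for r i j
    \<comment> \<open>\<open>y l r\<close> is the coefficient of w^l in P_k^* (x r). For each fixed
      \<open>l\<close> these form a test family for the assumed block positivity.\<close>
    define y where "y l r = hpoly (a + k) (\<lambda>i. g r i l)" for l r
    define S where "S l = (\<Sum>i<n. \<Sum>j<n. ipH (a + k) (A i j (y l j)) (y l i))" for l
    have S: "S l \<in> \<real> \<and> 0 \<le> Re (S l)" for l
      using pos unfolding block_pos_def S_def Let_def by (auto simp: y_def Hsp_eq)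
    have "(\<Sum>i<n. \<Sum>j<n. ipH (a + b) (Tmap (a + k) (b + k) k (A i j) (x j)) (x i))
      = (\<Sum>i<n. \<Sum>j<n. \<Sum>l\<le>b + k. ipH (a + k) (A i j (y l j)) (y l i) / of_nat (b + k choose l))"
    proof (intro sum.cong refl)
      fix i j assume ij: "i \<in> {..<n}" "j \<in> {..<n}"
      have adj: "Pk_adj (a + k) (b + k) k (x r) = tpoly (a + k) (b + k) (g r)" if "r < n" for r
        unfolding d[OF that] Pk_adj_hpoly g_def ..
      have "ipH (a + b) (Tmap (a + k) (b + k) k (A i j) (x j)) (x i)
        = ipT (a + k) (b + k) (tensorI (A i j) (tpoly (a + k) (b + k) (g j))) (tpoly (a + k) (b + k) (g i))"
        using ij x A by (subst ipH_Tmap) (auto simp: adj)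
      then show "ipH (a + b) (Tmap (a + k) (b + k) k (A i j) (x j)) (x i)
        = (\<Sum>l\<le>b + k. ipH (a + k) (A i j (y l j)) (y l i) / of_nat (b + k choose l))"
        using ij A by (simp add: ipT_tensorI y_def)
    qed
    also have "\<dots> = (\<Sum>i<n. \<Sum>l\<le>b + k. \<Sum>j<n. ipH (a + k) (A i j (y l j)) (y l i) / of_nat (b + k choose l))"
      by (intro sum.cong refl sum.swap)
    also have "\<dots> = (\<Sum>l\<le>b + k. \<Sum>i<n. \<Sum>j<n. ipH (a + k) (A i j (y l j)) (y l i) / of_nat (b + k choose l))"
      by (rule sum.swap)
    also have "\<dots> = (\<Sum>l\<le>b + k. S l / of_nat (b + k choose l))"
      by (simp add: S_def sum_divide_distrib)
    finally have *: "(\<Sum>i<n. \<Sum>j<n. ipH (a + b) (Tmap (a + k) (b + k) k (A i j) (x j)) (x i))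
      = (\<Sum>l\<le>b + k. S l / of_nat (b + k choose l))" .
    have "S l / of_nat (b + k choose l) \<in> \<real>" "0 \<le> Re (S l / of_nat (b + k choose l))" for l
      using S[of l] by auto
    then show "let s = \<Sum>i<n. \<Sum>j<n. ipH (a + b) (Tmap (a + k) (b + k) k (A i j) (x j)) (x i) in s \<in> \<real> \<and> 0 \<le> Re s"
      unfolding * Let_def by (auto intro!: sum_nonneg)
  qed
qed

end

section \<open>Rescaling to the trace-preserving normalisation\<close>

lemma ipH_scale_left: "ipH \<tau> (\<lambda>z. c * f z) g = c * ipH \<tau> f g"
  by (simp add: ipH_def mult.assoc)

lemma completely_positive_scale:
  assumes "completely_positive \<sigma> \<tau> T" "0 \<le> (c::real)"
  shows "completely_positive \<sigma> \<tau> (\<lambda>A g z. of_real c * T A g z)"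
  using assms unfolding completely_positive_def block_pos_def Let_def ipH_scale_left sum_distrib_left[symmetric]
  by (auto simp: complex_is_Real_iff)

lemma Bop_scale:
  assumes "A \<in> Bop \<tau>"
  shows "(\<lambda>g z. c * A g z) \<in> Bop \<tau>"
proof -
  have "(\<lambda>z. c * hpoly \<tau> d z) = hpoly \<tau> (\<lambda>i. c * d i)" for d
    by (simp add: hpoly_def sum_distrib_left mult.assoc)
  then have "(\<lambda>z. c * f z) \<in> Hsp \<tau>" if "f \<in> Hsp \<tau>" for f
    using that by (auto simp: Hsp_eq)
  then show ?thesis using assms by (auto simp: Bop_def lin_on_def algebra_simps)
qed

lemma trH_scale:
  assumes "A \<in> Bop \<tau>"
  shows "trH \<tau> (\<lambda>g z. c * A g z) = c * trH \<tau> A"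
proof -
  obtain \<alpha> where \<alpha>: "\<And>i. i \<le> \<tau> \<Longrightarrow> A (\<lambda>z. z ^ i) = hpoly \<tau> (\<lambda>b. \<alpha> b i)"
    by (rule Bop_hpoly[OF assms]) blast
  have "(\<lambda>z. c * hpoly \<tau> d z) = hpoly \<tau> (\<lambda>i. c * d i)" for d
    by (simp add: hpoly_def sum_distrib_left mult.assoc)
  then show ?thesis by (simp add: trH_def \<alpha> pcoeff_hpoly sum_distrib_left)
qed

theorem mainTheorem2:
  fixes \<mu> \<nu> k :: nat
  assumes "k \<le> \<mu>" and "\<mu> < \<nu>"
  shows "(\<forall>A\<in>Bop \<mu>. Tmap \<mu> \<nu> k A \<in> Bop (\<mu> + \<nu> - 2 * k))
    \<and> completely_positive \<mu> (\<mu> + \<nu> - 2 * k) (Tmap \<mu> \<nu> k)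
    \<and> (\<forall>A\<in>Bop \<mu>. That \<mu> \<nu> k A \<in> Bop (\<mu> + \<nu> - 2 * k))
    \<and> completely_positive \<mu> (\<mu> + \<nu> - 2 * k) (That \<mu> \<nu> k)
    \<and> trace_preserving \<mu> (\<mu> + \<nu> - 2 * k) (That \<mu> \<nu> k)"
proof -
  obtain a where \<mu>: "\<mu> = a + k" using assms(1) by (metis le_add_diff_inverse2)
  obtain b where \<nu>: "\<nu> = b + k" using assms by (metis le_add_diff_inverse2 less_imp_le order_trans)
  have \<tau>: "a + k + (b + k) - 2 * k = a + b" by simp
  \<comment> \<open>The reciprocal of the factor by which \<open>Tmap\<close> multiplies
    traces.\<close>
  define c where "c = (real (a + k) + 1) / (real (a + b) + 1)"
  have That: "That (a + k) (b + k) k = (\<lambda>A g z. of_real c * Tmap (a + k) (b + k) k A g z)"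
    unfolding That_def \<tau> c_def ..
  have c: "0 \<le> c" "c * ((real (a + b) + 1) / (real (a + k) + 1)) = 1"
    by (simp_all add: c_def)
  have "trace_preserving (a + k) (a + b) (That (a + k) (b + k) k)"
    unfolding trace_preserving_def That
  proof
    fix A assume A: "A \<in> Bop (a + k)"
    show "trH (a + b) (\<lambda>g z. of_real c * Tmap (a + k) (b + k) k A g z) = trH (a + k) A"
      unfolding trH_scale[OF Tmap_Bop[OF A]] trace_Tmap[OF A] mult.assoc[symmetric] of_real_mult[symmetric] c(2)
      by simp
  qed
  then show ?thesis
    using c(1) unfolding \<mu> \<nu> \<tau>
    by (auto simp: That intro: Tmap_Bop Bop_scale completely_positive_Tmap completely_positive_scale)
qed

end
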